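(* Let $S=(E,\mathcal A,\mu,T)$ be a dynamical system, $f:E\to[0,1]$ measurable, $\beta>0$, $J>0$, and let $G$, $L$, $P_{n,x}$, $M_n$ be as defined in the context. Let $m$ be a (local or global) minimum of $G$ of type $2k$ and strength $\lambda$, and assume that for every $j\in\{1,\dots,2k\}$ the function $y\mapsto\frac{\partial^j}{\partial s^j}L(f(y),\beta Jm)$ belongs to the class $\mathcal C_{j/(2k)}(S)$. Let $x\in E$. Then there exists $A=A(m)>0$ such that for all $0<a<A$ and for every $\alpha$ with $1-\frac1{2k}<\alpha<1$ the sequence of probability measures $$\left\{P_{n,x}\left(\frac{M_n-nm}{n^\alpha}\in\bullet\;\Big|\;\frac{M_n}{n}\in[m-a,m+a]\right)\right\}_{n\in\mathbb N}$$ on $\mathbb R$ satisfies a moderate deviation principle, i.e. a large deviation principle, with speed $n^{1-2k+2k\alpha}$ and rate function $$I(z)=\begin{cases}\dfrac{z^2}{2\sigma^2},&k=1,\\[2mm]\lambda\dfrac{z^{2k}}{(2k)!},&k\ge2,\end{cases}\qquad\text{where }\sigma^2=\frac1\lambda-\frac1{\beta J}.$$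
   Context: A dynamical system $S=(E,\mathcal A,\mu,T)$ consists of a probability space $(E,\mathcal A,\mu)$ and a measurable, measure-preserving map $T:E\to E$. Curie-Weiss model with dynamical external field: for $n\ge1$, $x\in E$, $P_{n,x}$ is the Gibbs probability measure on $\{-1,+1\}^n$ with $P_{n,x}(\sigma)=\frac1{Z_{n,x}}\exp(-H_{n,x}(\sigma))$, $$H_{n,x}(\sigma)=-\frac{\beta J}{2n}\Big(\sum_{i=1}^n\sigma_i\Big)^2-\frac12\sum_{i=1}^n\log\Big(\frac{f(T^ix)}{1-f(T^ix)}\Big)\sigma_i,$$ $Z_{n,x}$ being the normalizing constant; equivalently (and, when $f(T^ix)\in\{0,1\}$ for some $i$, by definition) $P_{n,x}(\sigma)$ is proportional to $\exp\big(\frac{\beta J}{2n}(\sum_{i=1}^n\sigma_i)^2\big)\prod_{i=1}^n w_i(\sigma_i)$ with $w_i(1)=f(T^ix)$, $w_i(-1)=1-f(T^ix)$. The total magnetization is $M_n(\sigma)=\sum_{i=1}^n\sigma_i$. Define $L:[0,1]\times\mathbb R\to\mathbb R$, $L(\phi,s)=\log(\phi e^s+(1-\phi)e^{-s})$, and $G(s)=\frac{\beta J}2s^2-\int_EL(f(y),\beta Js)\,d\mu(y)$, which is real analytic on $\mathbb R$. The notation $\frac{\partial^j}{\partial s^j}L(f(y),\beta Jm)$ means the $j$-th partial derivative of $L(\phi,s)$ in its second variable evaluated at $(\phi,s)=(f(y),\beta Jm)$. A minimum $m$ of $G$ has type $2k$ if $2k=\min\{j\ge1: G^{(j)}(m)\ne0\}$,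 and strength $\lambda=G^{(2k)}(m)>0$. For $\alpha\in[0,1]$, $\mathcal C_\alpha(S)$ is the class of $\mu$-integrable functions $h:E\to\mathbb R$ such that $\left|\sum_{i=1}^n\big(h(T^ix)-\int_Eh\,d\mu\big)\right|=o(n^\alpha)$ as $n\to\infty$, for every $x\in E$. Large deviation principle: probability measures $(\nu_n)$ on $\mathbb R$ satisfy an LDP with speed $\gamma_n\to\infty$ and (good) rate function $I:\mathbb R\to[0,\infty]$ if $I$ is lower semicontinuous with compact level sets $\{I\le c\}$, $c\in[0,\infty)$, $\liminf_n\frac1{\gamma_n}\log\nu_n(U)\ge-\inf_UI$ for every open $U$, and $\limsup_n\frac1{\gamma_n}\log\nu_n(F)\le-\inf_FI$ for every closed $F$. The conditional measures are considered for all sufficiently large $n$ (so that the conditioning event has positive probability). If $\sigma^2=0$ in the case $k=1$, $z^2/(2\sigma^2)$ is read as $0$ for $z=0$ and $+\infty$ for $z\neq0$. *)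

theory Defs
  imports "HOL-Probability.Probability" "HOL-Library.Landau_Symbols"
begin

section \<open>Dynamical systems\<close>

locale dynamical_system = prob_space \<mu> for \<mu> :: "'a measure" +
  fixes T :: "'a \<Rightarrow> 'a"
  assumes measurable_map: "T \<in> measurable \<mu> \<mu>"
    and measure_preserving: "distr \<mu> \<mu> T = \<mu>"

text \<open>The classes \<open>\<C>\<^sub>\<alpha>(S)\<close>. The bound is required for every point of the space,
  not only almost everywhere.\<close>

definition ergodic_class :: "'a measure \<Rightarrow> ('a \<Rightarrow> 'a) \<Rightarrow> real \<Rightarrow> ('a \<Rightarrow> real) set" where
  "ergodic_class \<mu> T \<alpha> = {h. integrable \<mu> h \<and>
     (\<forall>x\<in>space \<mu>. (\<lambda>n. \<bar>\<Sum>i=1..n. (h ((T ^^ i) x) - (\<integral>y. h y \<partial>\<mu>))\<bar>) \<in> o(\<lambda>n. real n powr \<alpha>))}"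

section \<open>The Curie--Weiss model with dynamical external field\<close>

definition spin_configs :: "nat \<Rightarrow> (nat \<Rightarrow> real) set" where
  "spin_configs n = {1..n} \<rightarrow>\<^sub>E {-1, 1}"

definition magnetization :: "nat \<Rightarrow> (nat \<Rightarrow> real) \<Rightarrow> real" where
  "magnetization n \<sigma> = (\<Sum>i=1..n. \<sigma> i)"

definition gibbs_weight ::
    "real \<Rightarrow> real \<Rightarrow> ('a \<Rightarrow> real) \<Rightarrow> ('a \<Rightarrow> 'a) \<Rightarrow> nat \<Rightarrow> 'a \<Rightarrow> (nat \<Rightarrow> real) \<Rightarrow> real" where
  "gibbs_weight \<beta> J f T n x \<sigma> =
     exp (\<beta> * J / (2 * real n) * (magnetization n \<sigma>)\<^sup>2) *
     (\<Prod>i=1..n. if \<sigma> i = 1 then f ((T ^^ i) x) else 1 - f ((T ^^ i) x))"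

text \<open>The Gibbs measure \<open>P\<^sub>n\<^sub>,\<^sub>x\<close>, in the product form that also makes sense when \<open>f (T\<^sup>i x)\<close> is
  0 or 1. Lemma \<open>gibbs_measure_eq_hamiltonian\<close> below is the form with the Hamiltonian.\<close>

definition gibbs_measure ::
    "real \<Rightarrow> real \<Rightarrow> ('a \<Rightarrow> real) \<Rightarrow> ('a \<Rightarrow> 'a) \<Rightarrow> nat \<Rightarrow> 'a \<Rightarrow> (nat \<Rightarrow> real) measure" where
  "gibbs_measure \<beta> J f T n x = point_measure (spin_configs n)
     (\<lambda>\<sigma>. ennreal (gibbs_weight \<beta> J f T n x \<sigma> / (\<Sum>\<tau>\<in>spin_configs n. gibbs_weight \<beta> J f T n x \<tau>)))"

definition hamiltonian ::
    "real \<Rightarrow> real \<Rightarrow> ('a \<Rightarrow> real) \<Rightarrow> ('a \<Rightarrow> 'a) \<Rightarrow> nat \<Rightarrow> 'a \<Rightarrow> (nat \<Rightarrow> real) \<Rightarrow> real" where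
  "hamiltonian \<beta> J f T n x \<sigma> =
     - (\<beta> * J / (2 * real n)) * (\<Sum>i=1..n. \<sigma> i)\<^sup>2
     - 1 / 2 * (\<Sum>i=1..n. ln (f ((T ^^ i) x) / (1 - f ((T ^^ i) x))) * \<sigma> i)"

lemma finite_spin_configs [simp]: "finite (spin_configs n)"
  by (auto simp: spin_configs_def intro!: finite_PiE)

lemma gibbs_measure_eq_hamiltonian:
  assumes "\<And>i. i \<in> {1..n} \<Longrightarrow> 0 < f ((T ^^ i) x) \<and> f ((T ^^ i) x) < 1"
  shows "gibbs_measure \<beta> J f T n x = point_measure (spin_configs n)
     (\<lambda>\<sigma>. ennreal (exp (- hamiltonian \<beta> J f T n x \<sigma>) /
       (\<Sum>\<tau>\<in>spin_configs n. exp (- hamiltonian \<beta> J f T n x \<tau>))))"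
proof -
  let ?p = "\<lambda>i. f ((T ^^ i) x)"
  define C where "C = (\<Prod>i=1..n. exp ((ln (?p i) + ln (1 - ?p i)) / 2))"
  have C: "C > 0"
    unfolding C_def by (intro prod_pos) auto
  have weight: "gibbs_weight \<beta> J f T n x \<sigma> = C * exp (- hamiltonian \<beta> J f T n x \<sigma>)"
    if \<sigma>: "\<sigma> \<in> spin_configs n" for \<sigma>
  proof -
    have factor: "(if \<sigma> i = 1 then ?p i else 1 - ?p i) =
        exp ((ln (?p i) + ln (1 - ?p i)) / 2) * exp (1 / 2 * (ln (?p i / (1 - ?p i)) * \<sigma> i))"
      if i: "i \<in> {1..n}" for i
    proof -
      have p: "0 < ?p i" "?p i < 1"
        using assms[OF i] by auto
      have "\<sigma> i = -1 \<or> \<sigma> i = 1"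
        using \<sigma> i by (auto simp: spin_configs_def PiE_def Pi_def)
      then show ?thesis
      proof
        assume s: "\<sigma> i = -1"
        have "exp ((ln (?p i) + ln (1 - ?p i)) / 2) * exp (1 / 2 * (ln (?p i / (1 - ?p i)) * \<sigma> i))
            = exp (ln (1 - ?p i))"
          using p unfolding s exp_add[symmetric] by (simp add: ln_div field_simps)
        then show ?thesis
          using p s by simp
      next
        assume s: "\<sigma> i = 1"
        have "exp ((ln (?p i) + ln (1 - ?p i)) / 2) * exp (1 / 2 * (ln (?p i / (1 - ?p i)) * \<sigma> i))
            = exp (ln (?p i))"
          using p unfolding s exp_add[symmetric] by (simp add: ln_div field_simps)
        then show ?thesis
          using p s by simp
      qed
    qed
    have "(\<Prod>i=1..n. if \<sigma> i = 1 then ?p i else 1 - ?p i) =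
        C * exp (1 / 2 * (\<Sum>i=1..n. ln (?p i / (1 - ?p i)) * \<sigma> i))"
      unfolding C_def sum_distrib_left exp_sum[OF finite_atLeastAtMost] prod.distrib[symmetric]
      by (intro prod.cong refl factor)
    moreover have "exp (- hamiltonian \<beta> J f T n x \<sigma>) =
        exp (\<beta> * J / (2 * real n) * (magnetization n \<sigma>)\<^sup>2) *
        exp (1 / 2 * (\<Sum>i=1..n. ln (?p i / (1 - ?p i)) * \<sigma> i))"
      unfolding exp_add[symmetric] hamiltonian_def magnetization_def by simp
    ultimately show ?thesis
      by (simp add: gibbs_weight_def)
  qed
  have "(\<Sum>\<tau>\<in>spin_configs n. gibbs_weight \<beta> J f T n x \<tau>) =
      C * (\<Sum>\<tau>\<in>spin_configs n. exp (- hamiltonian \<beta> J f T n x \<tau>))"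
    unfolding sum_distrib_left by (intro sum.cong refl weight)
  then show ?thesis
    unfolding gibbs_measure_def point_measure_def using C
    by (intro density_cong) (auto simp: AE_count_space weight)
qed

lemma prob_space_gibbs_measure:
  assumes "\<And>i. i \<in> {1..n} \<Longrightarrow> f ((T ^^ i) x) \<in> {0..1}"
  shows "prob_space (gibbs_measure \<beta> J f T n x)"
proof -
  let ?w = "gibbs_weight \<beta> J f T n x"
  let ?Z = "\<Sum>\<tau>\<in>spin_configs n. ?w \<tau>"
  have nonneg: "?w \<sigma> \<ge> 0" for \<sigma>
    using assms unfolding gibbs_weight_def by (intro mult_nonneg_nonneg prod_nonneg) auto
  define \<rho> where "\<rho> = restrict (\<lambda>i. if f ((T ^^ i) x) > 0 then 1 else (-1::real)) {1..n}"
  have \<rho>: "\<rho> \<in> spin_configs n"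
    by (auto simp: \<rho>_def spin_configs_def)
  have "?w \<rho> > 0"
    using assms unfolding gibbs_weight_def \<rho>_def
    by (intro mult_pos_pos prod_pos) (force simp: not_less)+
  then have Z: "?Z > 0"
    using \<rho> nonneg by (intro sum_pos2[of _ \<rho>]) auto
  have "emeasure (gibbs_measure \<beta> J f T n x) (spin_configs n) =
      (\<Sum>\<sigma>\<in>spin_configs n. ennreal (?w \<sigma> / ?Z))"
    unfolding gibbs_measure_def by (subst emeasure_point_measure_finite) auto
  also have "\<dots> = ennreal (\<Sum>\<sigma>\<in>spin_configs n. ?w \<sigma> / ?Z)"
    using nonneg Z by (intro sum_ennreal) (auto intro!: divide_nonneg_pos)
  also have "\<dots> = 1"
    using Z by (simp add: sum_divide_distrib[symmetric])
  finally show ?thesis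
    by (intro prob_spaceI) (simp add: gibbs_measure_def space_point_measure)
qed

text \<open>The law of \<open>(M\<^sub>n - n m) / n\<^sup>\<alpha>\<close> under \<open>P\<^sub>n\<^sub>,\<^sub>x\<close> conditioned on \<open>M\<^sub>n / n \<in> [m - a, m + a]\<close>.
  It is meaningful only when the conditioning event has positive probability.\<close>

definition conditional_law ::
    "real \<Rightarrow> real \<Rightarrow> ('a \<Rightarrow> real) \<Rightarrow> ('a \<Rightarrow> 'a) \<Rightarrow> 'a \<Rightarrow> real \<Rightarrow> real \<Rightarrow> real \<Rightarrow> nat \<Rightarrow> real measure" where
  "conditional_law \<beta> J f T x m a \<alpha> n =
     distr
       (uniform_measure (gibbs_measure \<beta> J f T n x)
         {\<sigma> \<in> spin_configs n. magnetization n \<sigma> / real n \<in> {m - a..m + a}})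
       borel
       (\<lambda>\<sigma>. (magnetization n \<sigma> - real n * m) / real n powr \<alpha>)"

definition CW_L :: "real \<Rightarrow> real \<Rightarrow> real" where
  "CW_L \<phi> s = ln (\<phi> * exp s + (1 - \<phi>) * exp (- s))"

definition CW_G :: "real \<Rightarrow> real \<Rightarrow> 'a measure \<Rightarrow> ('a \<Rightarrow> real) \<Rightarrow> real \<Rightarrow> real" where
  "CW_G \<beta> J \<mu> f s = \<beta> * J / 2 * s\<^sup>2 - (\<integral>y. CW_L (f y) (\<beta> * J * s) \<partial>\<mu>)"

section \<open>Type of a minimum\<close>

definition local_minimum :: "(real \<Rightarrow> real) \<Rightarrow> real \<Rightarrow> bool" where
  "local_minimum g m \<longleftrightarrow> (\<forall>\<^sub>F s in nhds m. g m \<le> g s)"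

text \<open>\<open>has_type g m j\<close> says \<open>j = min {i \<ge> 1. g\<^sup>(\<^sup>i\<^sup>)(m) \<noteq> 0}\<close>, including that this set is nonempty.\<close>

definition has_type :: "(real \<Rightarrow> real) \<Rightarrow> real \<Rightarrow> nat \<Rightarrow> bool" where
  "has_type g m j \<longleftrightarrow>
     j \<ge> 1 \<and> (deriv ^^ j) g m \<noteq> 0 \<and> (\<forall>i. 1 \<le> i \<and> i < j \<longrightarrow> (deriv ^^ i) g m = 0)"

section \<open>Large deviations\<close>

text \<open>The library has \<open>ln 0 = 0\<close> on the reals; here the logarithm of a null probability
  has to be \<open>-\<infinity>\<close>.\<close>

definition log_prob :: "real \<Rightarrow> ereal" where
  "log_prob p = (if p = 0 then -\<infinity> else ereal (ln p))"

definition good_rate_function :: "(real \<Rightarrow> ereal) \<Rightarrow> bool" where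
  "good_rate_function I \<longleftrightarrow>
     (\<forall>z. 0 \<le> I z) \<and>
     (\<forall>z. I z \<le> Liminf (at z) I) \<and>
     (\<forall>c\<ge>0. compact {z. I z \<le> ereal c})"

text \<open>The measures \<open>\<nu> n\<close> need to be probability measures only for large \<open>n\<close>; neither
  inequality depends on finitely many of them.\<close>

definition LDP :: "(nat \<Rightarrow> real measure) \<Rightarrow> (nat \<Rightarrow> real) \<Rightarrow> (real \<Rightarrow> ereal) \<Rightarrow> bool" where
  "LDP \<nu> \<gamma> I \<longleftrightarrow>
     (\<forall>\<^sub>F n in sequentially. prob_space (\<nu> n) \<and> sets (\<nu> n) = sets borel) \<and>
     filterlim \<gamma> at_top sequentially \<and>
     good_rate_function I \<and>
     (\<forall>U. open U \<longrightarrow>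
        liminf (\<lambda>n. log_prob (measure (\<nu> n) U) / ereal (\<gamma> n)) \<ge> - (INF z\<in>U. I z)) \<and>
     (\<forall>F. closed F \<longrightarrow>
        limsup (\<lambda>n. log_prob (measure (\<nu> n) F) / ereal (\<gamma> n)) \<le> - (INF z\<in>F. I z))"

text \<open>For \<open>k = 1\<close> and \<open>\<sigma>\<^sup>2 = 0\<close>, \<open>z\<^sup>2 / (2 \<sigma>\<^sup>2)\<close> is read as 0 at \<open>z = 0\<close> and \<open>\<infinity>\<close> elsewhere.\<close>

definition MDP_rate :: "nat \<Rightarrow> real \<Rightarrow> real \<Rightarrow> real \<Rightarrow> ereal" where
  "MDP_rate k lam sigma2 z =
     (if k = 1 then
        (if sigma2 = 0 then (if z = 0 then 0 else \<infinity>) else ereal (z\<^sup>2 / (2 * sigma2)))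
      else ereal (lam * z ^ (2 * k) / fact (2 * k)))"

end

theory Submission
  imports Defs "HOL-Computational_Algebra.Polynomial" "HOL-Real_Asymp.Real_Asymp"
begin

text \<open>
  Tilt the spins by \<open>s = \<beta> J m\<close>. Under the resulting product measure the Gibbs weight becomes
  \<open>exp (\<beta> J W\<^sup>2 / (2 n))\<close> with \<open>W = M\<^sub>n - n m\<close>, and \<open>W\<close> has the cumulant generating function
  \<open>\<Lambda>\<^sub>n t = (\<Sum>i\<le>n. L (f (T\<^sup>i x)) (s + t) - L (f (T\<^sup>i x)) s) - n m t\<close>. Its Taylor expansion of order
  \<open>2 k\<close>, together with the ergodic hypotheses and the vanishing of the derivatives of \<open>G\<close> at \<open>m\<close>,
  gives, with \<open>b = \<beta> J\<close> and speed \<open>\<gamma>\<^sub>n\<close>,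
  \<open>\<Lambda>\<^sub>n (\<xi> n\<^sup>\<alpha> / n) = n\<^sup>2\<^sup>\<alpha> \<xi>\<^sup>2 / (2 b n) - \<gamma>\<^sub>n (\<lambda> (\<xi> / b)\<^sup>2\<^sup>k / (2 k)! + o(1))\<close>.

  Upper bound: \<open>W\<close> takes at most \<open>n + 1\<close> values, a number negligible on the exponential scale, and
  the mass of a single value \<open>u n\<^sup>\<alpha>\<close> is estimated by Chernoff's inequality. With the tilt \<open>\<xi> = b u\<close> the
  quadratic terms, which for \<open>k \<ge> 2\<close> dwarf the speed, cancel exactly, so that no
  Hubbard--Stratonovich convolution is needed. For \<open>k = 1\<close> the optimal tilt is \<open>u / v\<close>, where
  \<open>v = \<integral> L'' (f y) s d\<mu>\<close>, or an arbitrarily large one if \<open>v = 0\<close>. Lower bound: the same tilt centres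
  \<open>W / n\<^sup>\<alpha>\<close> at a given point, and the concentration around it follows from Chernoff's inequality again.
\<close>

section \<open>Derivatives of \<open>L\<close> and \<open>G\<close>\<close>

text \<open>The mean of a single spin with weights \<open>\<phi>\<close> and
  \<open>1 - \<phi>\<close> after exponential tilting by \<open>s\<close>, which is the first
  derivative of \<open>CW_L \<phi>\<close>.\<close>

definition tilted_mean :: "real \<Rightarrow> real \<Rightarrow> real" where
  "tilted_mean \<phi> s =
     (\<phi> * exp s - (1 - \<phi>) * exp (- s)) / (\<phi> * exp s + (1 - \<phi>) * exp (- s))"

text \<open>Since the tilted mean \<open>u\<close> satisfies \<open>u' = 1 - u\<^sup>2\<close>, each
  derivative of \<open>L\<close> is a polynomial in \<open>u\<close> whose coefficients depend on
  neither \<open>\<phi>\<close> nor \<open>s\<close>. The index is shifted: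
  \<open>cumulant_poly j\<close> belongs to the derivative of order \<open>j + 1\<close>.\<close>

primrec cumulant_poly :: "nat \<Rightarrow> real poly" where
  "cumulant_poly 0 = [:0, 1:]"
| "cumulant_poly (Suc j) = pderiv (cumulant_poly j) * [:1, 0, -1:]"

lemma two_point_mgf_pos:
  fixes \<phi> s :: real
  assumes "\<phi> \<in> {0..1}"
  shows "\<phi> * exp s + (1 - \<phi>) * exp (- s) > 0"
proof (cases "\<phi> = 0")
  case False
  then have "\<phi> * exp s > 0" "(1 - \<phi>) * exp (- s) \<ge> 0"
    using assms by auto
  then show ?thesis by linarith
qed simp

lemma abs_tilted_mean_le_1:
  assumes "\<phi> \<in> {0..1}"
  shows "\<bar>tilted_mean \<phi> s\<bar> \<le> 1"
proof -
  have "\<phi> * exp s \<ge> 0" "(1 - \<phi>) * exp (- s) \<ge> 0"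
    using assms by auto
  then show ?thesis
    using two_point_mgf_pos[OF assms, of s] by (auto simp: tilted_mean_def abs_if field_simps)
qed

lemma has_real_derivative_CW_L:
  assumes "\<phi> \<in> {0..1}"
  shows "(CW_L \<phi> has_real_derivative tilted_mean \<phi> s) (at s)"
  unfolding CW_L_def tilted_mean_def
  using two_point_mgf_pos[OF assms, of s]
  by (auto intro!: derivative_eq_intros simp: field_simps)

lemma has_real_derivative_tilted_mean:
  assumes "\<phi> \<in> {0..1}"
  shows "(tilted_mean \<phi> has_real_derivative 1 - (tilted_mean \<phi> s)\<^sup>2) (at s)"
proof -
  let ?D = "\<phi> * exp s + (1 - \<phi>) * exp (- s)"
  have D: "?D > 0" by (rule two_point_mgf_pos[OF assms])
  have "(tilted_mean \<phi> has_real_derivative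
      (?D * ?D - (\<phi> * exp s - (1 - \<phi>) * exp (- s)) * (\<phi> * exp s - (1 - \<phi>) * exp (- s)))
        / (?D * ?D)) (at s)"
    unfolding tilted_mean_def using D
    by (auto intro!: derivative_eq_intros simp: algebra_simps)
  also have "(?D * ?D - (\<phi> * exp s - (1 - \<phi>) * exp (- s)) * (\<phi> * exp s - (1 - \<phi>) * exp (- s)))
        / (?D * ?D) = 1 - (tilted_mean \<phi> s)\<^sup>2"
    unfolding tilted_mean_def power_divide using D by (simp add: power2_eq_square diff_divide_distrib[of "?D * ?D"])
  finally show ?thesis .
qed

lemma deriv_funpow_CW_L:
  assumes "\<phi> \<in> {0..1}"
  shows "(deriv ^^ Suc j) (CW_L \<phi>) = (\<lambda>s. poly (cumulant_poly j) (tilted_mean \<phi> s))"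
proof (induction j)
  case 0
  show ?case
    using DERIV_imp_deriv[OF has_real_derivative_CW_L[OF assms]] by auto
next
  case (Suc j)
  have "deriv (\<lambda>s. poly (cumulant_poly j) (tilted_mean \<phi> s)) s =
      poly (cumulant_poly (Suc j)) (tilted_mean \<phi> s)" for s
    by (intro DERIV_imp_deriv)
      (auto intro!: derivative_eq_intros DERIV_chain2[OF poly_DERIV]
        has_real_derivative_tilted_mean[OF assms] simp: power2_eq_square algebra_simps)
  then show ?case
    using Suc.IH by simp
qed

text \<open>\<open>deriv\<close> is total, so its iterates alone do not assert differentiability;
  the polynomial form supplies it at every order.\<close>

lemma has_real_derivative_deriv_funpow_CW_L:
  assumes "\<phi> \<in> {0..1}"
  shows "((deriv ^^ j) (CW_L \<phi>) has_real_derivative (deriv ^^ Suc j) (CW_L \<phi>) s) (at s)"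
proof (cases j)
  case 0
  then show ?thesis
    using has_real_derivative_CW_L[OF assms] deriv_funpow_CW_L[OF assms, of 0] by simp
next
  case (Suc i)
  show ?thesis
    unfolding Suc deriv_funpow_CW_L[OF assms]
    by (auto intro!: derivative_eq_intros DERIV_chain2[OF poly_DERIV]
        has_real_derivative_tilted_mean[OF assms] simp: power2_eq_square algebra_simps)
qed

text \<open>The tilted mean stays in the compact interval \<open>{-1..1}\<close>, on which a fixed
  polynomial is bounded. Uniformity in \<open>\<phi>\<close> and \<open>s\<close> makes all later
  Taylor remainders uniform along the orbit.\<close>

lemma deriv_funpow_CW_L_bounded:
  "\<exists>C>0. \<forall>\<phi>\<in>{0..1}. \<forall>s. \<bar>(deriv ^^ Suc j) (CW_L \<phi>) s\<bar> \<le> C"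
proof -
  have "compact (poly (cumulant_poly j) ` {-1..1})"
    by (intro compact_continuous_image continuous_intros) auto
  then obtain C where C: "C > 0" "\<And>u. u \<in> {-1..1} \<Longrightarrow> \<bar>poly (cumulant_poly j) u\<bar> \<le> C"
    using compact_imp_bounded bounded_pos[of "poly (cumulant_poly j) ` {-1..1}"] by auto
  have "\<bar>(deriv ^^ Suc j) (CW_L \<phi>) s\<bar> \<le> C" if "\<phi> \<in> {0..1}" for \<phi> s
    unfolding deriv_funpow_CW_L[OF that]
    using abs_tilted_mean_le_1[OF that, of s] by (intro C(2)) (auto simp: abs_le_iff)
  with C(1) show ?thesis by blast
qed

text \<open>The second derivative is the variance of the tilted spin.\<close>

lemma deriv2_CW_L_nonneg:
  assumes "\<phi> \<in> {0..1}"
  shows "(deriv ^^ 2) (CW_L \<phi>) s \<ge> 0"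
proof -
  have "(deriv ^^ 2) (CW_L \<phi>) s = 1 - (tilted_mean \<phi> s)\<^sup>2"
    using deriv_funpow_CW_L[OF assms, of 1] by (simp add: numeral_2_eq_2 pderiv_pCons)
  moreover have "(tilted_mean \<phi> s)\<^sup>2 \<le> 1"
    using abs_tilted_mean_le_1[OF assms, of s] by (simp add: abs_square_le_1)
  ultimately show ?thesis by simp
qed

text \<open>The two-point generating function lies between \<open>exp (- \<bar>s\<bar>)\<close> and
  \<open>exp \<bar>s\<bar>\<close>. This gives integrability at order 0, where the polynomial bound
  does not apply.\<close>

lemma abs_CW_L_le:
  assumes "\<phi> \<in> {0..1}"
  shows "\<bar>CW_L \<phi> s\<bar> \<le> \<bar>s\<bar>"
proof -
  have "\<phi> * exp s + (1 - \<phi>) * exp (- s) \<le> \<phi> * exp \<bar>s\<bar> + (1 - \<phi>) * exp \<bar>s\<bar>"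
    using assms by (intro add_mono mult_left_mono) auto
  moreover have "\<phi> * exp (- \<bar>s\<bar>) + (1 - \<phi>) * exp (- \<bar>s\<bar>) \<le> \<phi> * exp s + (1 - \<phi>) * exp (- s)"
    using assms by (intro add_mono mult_left_mono) auto
  ultimately have *: "\<phi> * exp s + (1 - \<phi>) * exp (- s) \<le> exp \<bar>s\<bar>"
    "exp (- \<bar>s\<bar>) \<le> \<phi> * exp s + (1 - \<phi>) * exp (- s)"
    by (simp_all add: algebra_simps)
  have "CW_L \<phi> s \<le> \<bar>s\<bar>"
    unfolding CW_L_def using two_point_mgf_pos[OF assms, of s] *(1)
    by (metis ln_exp ln_mono)
  moreover have "- \<bar>s\<bar> \<le> CW_L \<phi> s"
    unfolding CW_L_def using two_point_mgf_pos[OF assms, of s] *(2)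
    by (metis exp_gt_zero ln_exp ln_mono)
  ultimately show ?thesis by linarith
qed

text \<open>Lagrange's form of the remainder, with its factorial bounded below by 1; only the power
  of \<open>t\<close> matters later.\<close>

lemma taylor_abs_le:
  fixes g :: "nat \<Rightarrow> real \<Rightarrow> real"
  assumes deriv: "\<And>j s. (g j has_real_derivative g (Suc j) s) (at s)"
    and bound: "\<And>s. \<bar>g (Suc n) s\<bar> \<le> C"
  shows "\<bar>g 0 (s + t) - (\<Sum>j\<le>n. g j s / fact j * t ^ j)\<bar> \<le> C * \<bar>t\<bar> ^ Suc n"
proof -
  have D: "((\<lambda>t. g j (s + t)) has_real_derivative g (Suc j) (s + t)) (at t)" for j t
    using DERIV_shift[of "g j" "g (Suc j) (s + t)" t s] deriv[of j "s + t"]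
    by (simp add: add.commute)
  obtain u where u: "g 0 (s + t) = (\<Sum>j<Suc n. g j (s + 0) / fact j * t ^ j)
      + g (Suc n) (s + u) / fact (Suc n) * t ^ Suc n"
    using Maclaurin_all_le[of "\<lambda>j t. g j (s + t)" "\<lambda>t. g 0 (s + t)" t "Suc n"] D by auto
  have "\<bar>g (Suc n) (s + u)\<bar> * \<bar>t ^ Suc n\<bar> / fact (Suc n) \<le> C * \<bar>t\<bar> ^ Suc n / 1"
    using bound[of "s + u"] order_trans[OF abs_ge_zero bound]
    by (intro frac_le mult_mono fact_ge_1) (auto simp: power_abs abs_mult)
  then show ?thesis
    unfolding u by (simp add: lessThan_Suc_atMost abs_mult del: fact_Suc power_Suc)
qed

section \<open>Derivatives of \<open>G\<close> by differentiation under the integral\<close>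

definition CW_G_deriv :: "'a measure \<Rightarrow> ('a \<Rightarrow> real) \<Rightarrow> real \<Rightarrow> nat \<Rightarrow> real \<Rightarrow> real" where
  "CW_G_deriv \<mu> f b j s =
     (if j = 0 then b / 2 * s\<^sup>2 else if j = 1 then b * s else if j = 2 then b else 0)
       - b ^ j * (\<integral>y. (deriv ^^ j) (CW_L (f y)) (b * s) \<partial>\<mu>)"

context dynamical_system
begin

context
  fixes f :: "'a \<Rightarrow> real"
  assumes f_measurable [measurable]: "f \<in> borel_measurable \<mu>"
    and f_range: "\<And>y. y \<in> space \<mu> \<Longrightarrow> f y \<in> {0..1}"
begin

lemma integrable_deriv_funpow_CW_L: "integrable \<mu> (\<lambda>y. (deriv ^^ j) (CW_L (f y)) s)"
proof (cases j)
  case 0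
  have "integrable \<mu> (\<lambda>y. CW_L (f y) s)"
    by (intro integrable_const_bound[of _ "\<bar>s\<bar>"] AE_I2)
      (auto simp: CW_L_def intro!: abs_CW_L_le[unfolded CW_L_def] f_range)
  with 0 show ?thesis by simp
next
  case (Suc i)
  obtain C where C: "\<And>\<phi> s. \<phi> \<in> {0..1} \<Longrightarrow> \<bar>(deriv ^^ Suc i) (CW_L \<phi>) s\<bar> \<le> C"
    using deriv_funpow_CW_L_bounded[of i] by metis
  have "continuous_on UNIV (poly (cumulant_poly i))"
    by (intro continuous_intros)
  then have [measurable]: "poly (cumulant_poly i) \<in> borel_measurable borel"
    by (rule borel_measurable_continuous_onI)
  have "(\<lambda>y. poly (cumulant_poly i) (tilted_mean (f y) s)) \<in> borel_measurable \<mu>"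
    unfolding tilted_mean_def by measurable
  then have "(\<lambda>y. (deriv ^^ j) (CW_L (f y)) s) \<in> borel_measurable \<mu>"
    unfolding Suc
    by (rule iffD2[OF measurable_cong, rotated]) (use deriv_funpow_CW_L[OF f_range] in metis)
  then show ?thesis
    using C f_range Suc by (intro integrable_const_bound[of _ C] AE_I2) auto
qed

text \<open>A second-order Taylor estimate whose constant is uniform in \<open>f y\<close> can be
  integrated over the space; after division by \<open>h\<close> the error is at most
  \<open>C * \<bar>h\<bar>\<close>.\<close>

lemma has_real_derivative_integral_CW_L:
  "((\<lambda>s. \<integral>y. (deriv ^^ j) (CW_L (f y)) s \<partial>\<mu>) has_real_derivative
     (\<integral>y. (deriv ^^ Suc j) (CW_L (f y)) s \<partial>\<mu>)) (at s)"
proof -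
  let ?F = "\<lambda>j s. \<integral>y. (deriv ^^ j) (CW_L (f y)) s \<partial>\<mu>"
  obtain C where C: "C > 0" "\<And>\<phi> s. \<phi> \<in> {0..1} \<Longrightarrow> \<bar>(deriv ^^ Suc (Suc j)) (CW_L \<phi>) s\<bar> \<le> C"
    using deriv_funpow_CW_L_bounded[of "Suc j"] by metis
  note int = integrable_deriv_funpow_CW_L
  have est: "\<bar>?F j (s + h) - ?F j s - ?F (Suc j) s * h\<bar> \<le> C * \<bar>h\<bar> ^ 2" for h
  proof -
    have "\<bar>(deriv ^^ j) (CW_L (f y)) (s + h) - (deriv ^^ j) (CW_L (f y)) s
        - (deriv ^^ Suc j) (CW_L (f y)) s * h\<bar> \<le> C * \<bar>h\<bar> ^ 2" if "y \<in> space \<mu>" for y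
      using taylor_abs_le[of "\<lambda>i. (deriv ^^ (i + j)) (CW_L (f y))" 1 C s h]
        has_real_derivative_deriv_funpow_CW_L[OF f_range[OF that]] C(2)[OF f_range[OF that]]
      by (simp add: numeral_2_eq_2 diff_diff_eq)
    then have "\<bar>\<integral>y. (deriv ^^ j) (CW_L (f y)) (s + h) - (deriv ^^ j) (CW_L (f y)) s
        - (deriv ^^ Suc j) (CW_L (f y)) s * h \<partial>\<mu>\<bar> \<le> C * \<bar>h\<bar> ^ 2"
      using int[of j] int[of "Suc j"]
      by (intro order_trans[OF integral_abs_bound integral_le_const] integrable_abs
          Bochner_Integration.integrable_diff integrable_mult_left AE_I2) auto
    also have "(\<integral>y. (deriv ^^ j) (CW_L (f y)) (s + h) - (deriv ^^ j) (CW_L (f y)) s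
        - (deriv ^^ Suc j) (CW_L (f y)) s * h \<partial>\<mu>) = ?F j (s + h) - ?F j s - ?F (Suc j) s * h"
      using int[of j] int[of "Suc j"] by (simp del: funpow.simps)
    finally show ?thesis .
  qed
  have "(\<lambda>h. (?F j (s + h) - ?F j s) / h - ?F (Suc j) s) \<midarrow>0\<rightarrow> 0"
  proof (rule Lim_null_comparison)
    show "((\<lambda>h. C * \<bar>h\<bar>) \<longlongrightarrow> 0) (at 0)"
      by (auto intro!: tendsto_eq_intros)
    show "\<forall>\<^sub>F h in at 0. norm ((?F j (s + h) - ?F j s) / h - ?F (Suc j) s) \<le> C * \<bar>h\<bar>"
      unfolding eventually_at_filter
    proof (intro always_eventually allI impI)
      fix h :: real assume "h \<noteq> 0"
      then have "(?F j (s + h) - ?F j s) / h - ?F (Suc j) s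
          = (?F j (s + h) - ?F j s - ?F (Suc j) s * h) / h"
        by (simp add: diff_divide_distrib del: funpow.simps)
      then show "norm ((?F j (s + h) - ?F j s) / h - ?F (Suc j) s) \<le> C * \<bar>h\<bar>"
        using est[of h] \<open>h \<noteq> 0\<close>
        by (simp add: abs_divide pos_divide_le_eq power2_eq_square ac_simps del: funpow.simps)
    qed
  qed
  then show ?thesis
    unfolding DERIV_def LIM_zero_iff .
qed

lemma has_real_derivative_CW_G_deriv:
  "(CW_G_deriv \<mu> f b j has_real_derivative CW_G_deriv \<mu> f b (Suc j) s) (at s)"
proof -
  have I: "((\<lambda>s. \<integral>y. (deriv ^^ j) (CW_L (f y)) (b * s) \<partial>\<mu>) has_real_derivative
     (\<integral>y. (deriv ^^ Suc j) (CW_L (f y)) (b * s) \<partial>\<mu>) * b) (at s)"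
    by (rule DERIV_chain2[OF has_real_derivative_integral_CW_L])
      (auto intro!: derivative_eq_intros)
  have "((\<lambda>s. if j = 0 then b / 2 * s\<^sup>2 else if j = 1 then b * s else if j = 2 then b else 0)
      has_real_derivative (if Suc j = 0 then b / 2 * s\<^sup>2 else if Suc j = 1 then b * s
        else if Suc j = 2 then b else 0)) (at s)"
    by (cases "j = 0"; cases "j = 1"; cases "j = 2") (auto intro!: derivative_eq_intros)
  from DERIV_diff[OF this DERIV_cmult[OF I, of "b ^ j"]]
  show ?thesis
    unfolding CW_G_deriv_def[abs_def] by (simp add: ac_simps del: funpow.simps)
qed

lemma deriv_funpow_CW_G: "(deriv ^^ j) (CW_G \<beta> J \<mu> f) = CW_G_deriv \<mu> f (\<beta> * J) j"
proof (induction j)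
  case 0
  show ?case
    by (auto simp: CW_G_def CW_G_deriv_def fun_eq_iff)
next
  case (Suc j)
  have "deriv (CW_G_deriv \<mu> f (\<beta> * J) j) = CW_G_deriv \<mu> f (\<beta> * J) (Suc j)"
    using DERIV_imp_deriv[OF has_real_derivative_CW_G_deriv] by blast
  with Suc show ?case by simp
qed

end

end

text \<open>If the first nonvanishing derivative were negative, it would remain so near
  \<open>m\<close>, and Taylor's formula would give a value below \<open>g 0 m\<close> just to the
  right of \<open>m\<close>. This yields the positivity of the strength.\<close>

lemma local_minimum_deriv_pos:
  fixes g :: "nat \<Rightarrow> real \<Rightarrow> real"
  assumes deriv: "\<And>j s. (g j has_real_derivative g (Suc j) s) (at s)"
    and min: "local_minimum (g 0) m"
    and zero: "\<And>j. 1 \<le> j \<Longrightarrow> j < 2 * k \<Longrightarrow> g j m = 0" and nonzero: "g (2 * k) m \<noteq> 0"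
    and k: "k \<ge> 1"
  shows "g (2 * k) m > 0"
proof (rule ccontr)
  assume "\<not> g (2 * k) m > 0"
  then have neg: "g (2 * k) m < 0"
    using nonzero by simp
  have "isCont (g (2 * k)) m"
    by (rule DERIV_isCont[OF deriv])
  then have "\<forall>\<^sub>F s in nhds m. g (2 * k) s < 0"
    using neg order_tendstoD(2)[of "g (2 * k)" "g (2 * k) m" "nhds m" 0]
    by (simp add: continuous_at filterlim_at_within_not_equal tendsto_nhds_iff)
  with min have "\<forall>\<^sub>F s in nhds m. g (2 * k) s < 0 \<and> g 0 m \<le> g 0 s"
    unfolding local_minimum_def by eventually_elim auto
  then obtain d where d: "d > 0" "\<And>s. dist s m < d \<Longrightarrow> g (2 * k) s < 0 \<and> g 0 m \<le> g 0 s"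
    unfolding eventually_nhds_metric by blast
  obtain t where t: "m < t" "t < m + d / 2" and eq:
    "g 0 (m + d / 2) = (\<Sum>j<2 * k. g j m / fact j * (m + d / 2 - m) ^ j)
       + g (2 * k) t / fact (2 * k) * (m + d / 2 - m) ^ (2 * k)"
    using Taylor_up[of "2 * k" g "g 0" m "m + d / 2" m] deriv k d(1) by auto
  have "(\<Sum>j<2 * k. g j m / fact j * (m + d / 2 - m) ^ j)
      = (\<Sum>j<2 * k. if j = 0 then g 0 m else 0)"
    using zero by (intro sum.cong refl) auto
  also have "\<dots> = g 0 m"
    using k by (subst sum.delta) auto
  finally have "g 0 (m + d / 2) = g 0 m + g (2 * k) t / fact (2 * k) * (d / 2) ^ (2 * k)"
    using eq by simp
  moreover have "g (2 * k) t / fact (2 * k) * (d / 2) ^ (2 * k) < 0"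
    using d(2)[of t] t d(1) by (intro mult_neg_pos divide_neg_pos zero_less_power) (auto simp: dist_real_def)
  moreover have "g 0 m \<le> g 0 (m + d / 2)"
    using d(2)[of "m + d / 2"] d(1) by (auto simp: dist_real_def)
  ultimately show False by linarith
qed

section \<open>Large deviations of normalized masses\<close>

lemma log_prob_divide_ge:
  assumes "exp (- g * c) \<le> p" and "g > 0"
  shows "ereal (- c) \<le> log_prob p / ereal g"
proof -
  have p: "p > 0"
    using assms(1) exp_gt_zero less_le_trans by blast
  then have "- g * c \<le> ln p"
    using assms(1) by (simp add: ln_ge_iff)
  then show ?thesis
    using assms(2) p by (simp add: log_prob_def field_simps)
qed

lemma log_prob_divide_le:
  assumes "p \<le> exp (- g * c)" and "g > 0" and "p \<ge> 0"
  shows "log_prob p / ereal g \<le> ereal (- c)"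
proof (cases "p = 0")
  case False
  then have "ln p \<le> - g * c"
    using assms by (metis exp_gt_zero ln_exp ln_mono order_le_less)
  then show ?thesis
    using assms(2) False by (simp add: log_prob_def field_simps)
qed (use assms(2) in \<open>simp add: log_prob_def\<close>)

text \<open>Normalization costs nothing on the exponential scale: since \<open>I\<close> is
  nonnegative and \<open>I 0 = 0\<close>, the two bounds applied to the whole line and to a ball
  around 0 show that the total mass is \<open>exp (o(\<gamma> n))\<close>.\<close>

lemma LDP_of_normalized_masses:
  fixes R :: "nat \<Rightarrow> real set \<Rightarrow> real"
  assumes \<gamma>: "filterlim \<gamma> at_top sequentially"
    and \<nu>: "\<And>n. n > 0 \<Longrightarrow> R n UNIV > 0 \<Longrightarrow> prob_space (\<nu> n) \<and> sets (\<nu> n) = sets borel \<and>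
      (\<forall>B\<in>sets borel. measure (\<nu> n) B = R n B / R n UNIV)"
    and good: "good_rate_function I" and I0: "I 0 = 0"
    and mono: "\<And>n A B. A \<subseteq> B \<Longrightarrow> R n A \<le> R n B" and nonneg: "\<And>n A. R n A \<ge> 0"
    and upper: "\<And>F c. closed F \<Longrightarrow> ereal c < (INF z\<in>F. I z) \<Longrightarrow>
      \<forall>\<^sub>F n in sequentially. R n F \<le> exp (- \<gamma> n * c)"
    and lower: "\<And>z c \<eta>. I z < ereal c \<Longrightarrow> \<eta> > 0 \<Longrightarrow>
      \<forall>\<^sub>F n in sequentially. exp (- \<gamma> n * c) \<le> R n (ball z \<eta>)"
  shows "LDP \<nu> \<gamma> I"
proof -
  have I_nonneg: "0 \<le> I z" for z
    using good by (simp add: good_rate_function_def)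
  have \<gamma>_pos: "\<forall>\<^sub>F n in sequentially. \<gamma> n > 0 \<and> n > 0"
    using filterlim_at_top_dense[THEN iffD1, OF \<gamma>, rule_format, of 0] eventually_gt_at_top[of 0]
    by eventually_elim auto
  have Z_upper: "\<forall>\<^sub>F n in sequentially. R n UNIV \<le> exp (\<gamma> n * \<epsilon>)" if "\<epsilon> > 0" for \<epsilon>
  proof -
    have "ereal (- \<epsilon>) < 0" using that by simp
    also have "0 \<le> (INF z\<in>UNIV. I z)" using I_nonneg by (intro INF_greatest)
    finally show ?thesis using upper[of UNIV "- \<epsilon>"] by simp
  qed
  have Z_lower: "\<forall>\<^sub>F n in sequentially. exp (- \<gamma> n * \<epsilon>) \<le> R n UNIV" if "\<epsilon> > 0" for \<epsilon>
    using lower[of 0 \<epsilon> 1] that I0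
    by (auto elim!: eventually_mono intro: order_trans[OF _ mono[OF subset_UNIV]])
  have Z_pos: "\<forall>\<^sub>F n in sequentially. R n UNIV > 0"
    using Z_lower[of 1] by (auto elim!: eventually_mono intro: less_le_trans[OF exp_gt_zero])
  show ?thesis
    unfolding LDP_def
  proof (intro conjI allI impI \<gamma> good)
    show "\<forall>\<^sub>F n in sequentially. prob_space (\<nu> n) \<and> sets (\<nu> n) = sets borel"
      using Z_pos \<gamma>_pos by eventually_elim (use \<nu> in blast)
  next
    fix U :: "real set" assume U: "open U"
    let ?X = "\<lambda>n. log_prob (measure (\<nu> n) U) / ereal (\<gamma> n)"
    have "- liminf ?X \<le> I z" if z: "z \<in> U" for z
    proof (cases "I z")
      case (real r)
      obtain \<eta> where \<eta>: "\<eta> > 0" "ball z \<eta> \<subseteq> U"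
        using U z open_contains_ball by blast
      \<comment> \<open>One half of \<open>\<epsilon>\<close> is spent on the mass of the ball, the
        other on the total mass.\<close>
      have "ereal (- r) \<le> liminf ?X + ereal \<epsilon>" if \<epsilon>: "\<epsilon> > 0" for \<epsilon>
      proof -
        have "I z < ereal (r + \<epsilon> / 2)" using real \<epsilon> by simp
        note low = lower[OF this \<eta>(1)]
        have "\<forall>\<^sub>F n in sequentially. ereal (- (r + \<epsilon>)) \<le> ?X n"
          using low Z_upper[OF half_gt_zero[OF \<epsilon>]] Z_pos \<gamma>_pos
        proof eventually_elim
          case (elim n)
          have "exp (- \<gamma> n * (r + \<epsilon>)) = exp (- \<gamma> n * (r + \<epsilon> / 2)) / exp (\<gamma> n * (\<epsilon> / 2))"
            unfolding exp_diff[symmetric] by (simp add: algebra_simps)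
          also have "\<dots> \<le> R n U / R n UNIV"
            using elim mono[OF \<eta>(2), of n] nonneg[of n U] by (intro frac_le) auto
          also have "\<dots> = measure (\<nu> n) U"
            using \<nu>[of n] elim U by simp
          finally show ?case
            using elim by (intro log_prob_divide_ge) auto
        qed
        then have "ereal (- (r + \<epsilon>)) \<le> liminf ?X"
          by (rule Liminf_bounded)
        then have "ereal (- (r + \<epsilon>)) + ereal \<epsilon> \<le> liminf ?X + ereal \<epsilon>"
          by (rule add_right_mono)
        then show ?thesis by simp
      qed
      then have "ereal (- r) \<le> liminf ?X"
        by (rule ereal_le_epsilon2)
      then show ?thesis
        using real ereal_uminus_le_reorder by simp
    qed (use I_nonneg[of z] in auto)
    then have "- liminf ?X \<le> (INF z\<in>U. I z)"
      by (intro INF_greatest)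
    then show "- (INF z\<in>U. I z) \<le> liminf ?X"
      by (simp add: ereal_uminus_le_reorder)
  next
    fix F :: "real set" assume F: "closed F"
    let ?X = "\<lambda>n. log_prob (measure (\<nu> n) F) / ereal (\<gamma> n)"
    \<comment> \<open>Comparison with every \<open>y\<close> below the infimum also covers an
      infinite infimum.\<close>
    have "y \<le> - limsup ?X" if y: "y < (INF z\<in>F. I z)" for y
    proof (cases y)
      case (real c)
      \<comment> \<open>The gap \<open>d - c\<close> pays for the normalization.\<close>
      obtain d where d: "ereal c < ereal d" "ereal d < (INF z\<in>F. I z)"
        using y real ereal_dense2 by blast
      have "d - c > 0" using d by simp
      have "\<forall>\<^sub>F n in sequentially. ?X n \<le> ereal (- c)"
        using upper[OF F d(2)] Z_lower[OF \<open>d - c > 0\<close>] Z_pos \<gamma>_pos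
      proof eventually_elim
        case (elim n)
        have "measure (\<nu> n) F = R n F / R n UNIV"
          using \<nu>[of n] elim F by simp
        also have "\<dots> \<le> exp (- \<gamma> n * d) / exp (- \<gamma> n * (d - c))"
          using elim by (intro frac_le) auto
        also have "\<dots> = exp (- \<gamma> n * c)"
          unfolding exp_diff[symmetric] by (simp add: algebra_simps)
        finally show ?case
          using elim by (intro log_prob_divide_le) auto
      qed
      then have "limsup ?X \<le> ereal (- c)"
        by (rule Limsup_bounded)
      then show ?thesis
        using real ereal_minus_le_minus[of "ereal (- c)" "limsup ?X"] by simp
    qed (use y in auto)
    then have "(INF z\<in>F. I z) \<le> - limsup ?X"
      by (rule dense_le)
    then show "limsup ?X \<le> - (INF z\<in>F. I z)"
      using ereal_minus_le_minus[of "- limsup ?X" "INF z\<in>F. I z"] by simp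
  qed
qed

section \<open>Exponential estimates for masses with a quadratic weight\<close>

lemma abs_power_le_1_plus:
  fixes \<xi> :: real
  assumes "j \<le> 2 * k"
  shows "\<bar>\<xi>\<bar> ^ j \<le> 1 + \<xi> ^ (2 * k)"
proof (cases "\<bar>\<xi>\<bar> \<le> 1")
  case True
  then have "\<bar>\<xi>\<bar> ^ j \<le> 1" by (intro power_le_one) auto
  moreover have "\<xi> ^ (2 * k) \<ge> 0" by simp
  ultimately show ?thesis by linarith
next
  case False
  then have "\<bar>\<xi>\<bar> ^ j \<le> \<bar>\<xi>\<bar> ^ (2 * k)"
    using assms by (intro power_increasing) auto
  then show ?thesis by (simp add: power_even_abs)
qed

text \<open>To be read with \<open>X = (M\<^sub>n - n m) / n\<^sup>\<alpha>\<close> under the tilted product measure \<open>q\<close>, the scale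
  \<open>N = n\<^sup>2\<^sup>\<alpha> / n\<close> of the quadratic interaction, the speed \<open>\<gamma>\<close>, \<open>\<rho> = n / n\<^sup>\<alpha>\<close>,
  \<open>\<kappa> = \<lambda> / (b\<^sup>2\<^sup>k (2 k)!)\<close>, and \<open>C\<close> a bound on the derivative of order \<open>2 k + 1\<close> of \<open>L\<close>.\<close>

locale quadratic_tilt =
  fixes \<Omega> :: "nat \<Rightarrow> 'c set" and q :: "nat \<Rightarrow> 'c \<Rightarrow> real" and X :: "nat \<Rightarrow> 'c \<Rightarrow> real"
    and N \<gamma> \<rho> \<delta> :: "nat \<Rightarrow> real" and \<Lambda> :: "nat \<Rightarrow> real \<Rightarrow> real" and a b \<kappa> C :: real and k :: nat
  assumes finite_\<Omega> [simp]: "finite (\<Omega> n)"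
    and q_nonneg: "\<omega> \<in> \<Omega> n \<Longrightarrow> q n \<omega> \<ge> 0"
    and b_pos: "b > 0" and \<kappa>_pos: "\<kappa> > 0" and k_pos: "k \<ge> 1" and C_nonneg: "C \<ge> 0"
    and a_pos: "a > 0" and a_small: "C * a * b ^ (2 * k + 1) \<le> \<kappa> * b ^ (2 * k) / 2"
    and \<gamma>_pos: "n > 0 \<Longrightarrow> \<gamma> n > 0" and N_pos: "n > 0 \<Longrightarrow> N n > 0" and \<rho>_pos: "n > 0 \<Longrightarrow> \<rho> n > 0"
    and \<gamma>_at_top: "filterlim \<gamma> at_top sequentially" and N_at_top: "filterlim N at_top sequentially"
    and \<rho>_at_top: "filterlim \<rho> at_top sequentially"
    and \<delta>_tendsto: "\<delta> \<longlonglongrightarrow> 0"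
    and \<gamma>_eq_N: "k = 1 \<Longrightarrow> \<gamma> n = N n"
    and \<gamma>_over_N: "k \<noteq> 1 \<Longrightarrow> (\<lambda>n. \<gamma> n / N n) \<longlonglongrightarrow> 0"
    and card_X: "\<epsilon> > 0 \<Longrightarrow> \<forall>\<^sub>F n in sequentially. real (card (X n ` \<Omega> n)) \<le> exp (\<gamma> n * \<epsilon>)"
    and mgf: "n > 0 \<Longrightarrow> (\<Sum>\<omega>\<in>\<Omega> n. q n \<omega> * exp (\<xi> * N n * X n \<omega>)) = exp (\<Lambda> n \<xi>)"
    and \<Lambda>_expansion: "n > 0 \<Longrightarrow>
      \<bar>\<Lambda> n \<xi> - (N n * \<xi>\<^sup>2 / (2 * b) - \<gamma> n * (\<kappa> * \<xi> ^ (2 * k)))\<bar>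
        \<le> \<gamma> n * (\<delta> n * (1 + \<xi> ^ (2 * k)) + C * \<bar>\<xi>\<bar> ^ (2 * k + 1) / \<rho> n)"
begin

text \<open>The unnormalized Gibbs mass in the scaled variable: the exponent is
  \<open>b W\<^sup>2 / (2 n)\<close>, and the bound by \<open>a * \<rho> n\<close> is the
  conditioning event \<open>M\<^sub>n / n \<in> [m - a, m + a]\<close>.\<close>

definition mass :: "nat \<Rightarrow> real set \<Rightarrow> real" where
  "mass n B = (\<Sum>\<omega>\<in>{\<omega>\<in>\<Omega> n. \<bar>X n \<omega>\<bar> \<le> a * \<rho> n \<and> X n \<omega> \<in> B}. q n \<omega> * exp (b * N n / 2 * (X n \<omega>)\<^sup>2))"

lemma mass_nonneg: "mass n B \<ge> 0"
  unfolding mass_def by (intro sum_nonneg mult_nonneg_nonneg) (auto intro: q_nonneg)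

lemma mass_mono: "A \<subseteq> B \<Longrightarrow> mass n A \<le> mass n B"
  unfolding mass_def by (intro sum_mono2) (auto intro!: q_nonneg mult_nonneg_nonneg)

lemma partial_mgf_le:
  assumes "n > 0" "S \<subseteq> \<Omega> n"
  shows "(\<Sum>\<omega>\<in>S. q n \<omega> * exp (\<xi> * N n * X n \<omega>)) \<le> exp (\<Lambda> n \<xi>)"
  unfolding mgf[OF assms(1), symmetric] using assms(2)
  by (intro sum_mono2) (auto intro!: q_nonneg mult_nonneg_nonneg)

text \<open>The error allowed in \<open>\<Lambda>_expansion\<close>, in units of the speed.\<close>

definition err :: "nat \<Rightarrow> real \<Rightarrow> real" where
  "err n \<xi> = \<delta> n * (1 + \<xi> ^ (2 * k)) + C * \<bar>\<xi>\<bar> ^ (2 * k + 1) / \<rho> n"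

text \<open>On a level set of \<open>X n\<close> the quadratic weight is constant, so Chernoff's
  inequality with tilt \<open>\<tau> * u\<close> applies. The terms of scale \<open>N\<close>
  combine into a multiple of \<open>(\<tau> - b)\<^sup>2\<close>, which vanishes for
  \<open>\<tau> = b\<close>.\<close>

lemma point_mass_le:
  assumes n: "n > 0"
  shows "(\<Sum>\<omega>\<in>{\<omega>\<in>\<Omega> n. X n \<omega> = u}. q n \<omega> * exp (b * N n / 2 * (X n \<omega>)\<^sup>2))
    \<le> exp (N n * (\<tau> - b)\<^sup>2 * u\<^sup>2 / (2 * b) - \<gamma> n * (\<kappa> * (\<tau> * u) ^ (2 * k) - err n (\<tau> * u)))"
proof -
  let ?S = "{\<omega>\<in>\<Omega> n. X n \<omega> = u}"
  have "(\<Sum>\<omega>\<in>?S. q n \<omega> * exp (b * N n / 2 * (X n \<omega>)\<^sup>2))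
      = (\<Sum>\<omega>\<in>?S. q n \<omega> * exp (\<tau> * u * N n * X n \<omega>)) * exp (b * N n / 2 * u\<^sup>2 - \<tau> * u * N n * u)"
    unfolding sum_distrib_right by (intro sum.cong refl) (simp add: exp_add[symmetric])
  also have "\<dots> \<le> exp (\<Lambda> n (\<tau> * u)) * exp (b * N n / 2 * u\<^sup>2 - \<tau> * u * N n * u)"
    by (intro mult_right_mono partial_mgf_le n) auto
  also have "\<dots> = exp (\<Lambda> n (\<tau> * u) + b * N n / 2 * u\<^sup>2 - \<tau> * u * N n * u)"
    unfolding exp_add[symmetric] by simp
  also have "\<dots> \<le> exp (N n * (\<tau> - b)\<^sup>2 * u\<^sup>2 / (2 * b) - \<gamma> n * (\<kappa> * (\<tau> * u) ^ (2 * k) - err n (\<tau> * u)))"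
  proof -
    have "\<Lambda> n (\<tau> * u) \<le> N n * (\<tau> * u)\<^sup>2 / (2 * b) - \<gamma> n * (\<kappa> * (\<tau> * u) ^ (2 * k))
        + \<gamma> n * err n (\<tau> * u)"
      using \<Lambda>_expansion[OF n, of "\<tau> * u"] by (simp add: err_def abs_le_iff)
    moreover have "N n * (\<tau> - b)\<^sup>2 * u\<^sup>2 / (2 * b)
        = N n * (\<tau> * u)\<^sup>2 / (2 * b) + b * N n / 2 * u\<^sup>2 - \<tau> * u * N n * u"
      using b_pos by (simp add: field_simps power2_eq_square)
    ultimately show ?thesis
      unfolding exp_le_cancel_iff right_diff_distrib by linarith
  qed
  finally show ?thesis .
qed

text \<open>Both constraints in \<open>mass\<close> depend on \<open>\<omega>\<close> only through
  \<open>X n \<omega>\<close>, so the mass is a sum over full level sets.\<close>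

lemma mass_le_card_mult:
  assumes "\<And>u. u \<in> B \<Longrightarrow> \<bar>u\<bar> \<le> a * \<rho> n \<Longrightarrow>
      (\<Sum>\<omega>\<in>{\<omega>\<in>\<Omega> n. X n \<omega> = u}. q n \<omega> * exp (b * N n / 2 * (X n \<omega>)\<^sup>2)) \<le> M"
    and "M \<ge> 0"
  shows "mass n B \<le> real (card (X n ` \<Omega> n)) * M"
proof -
  let ?S = "{\<omega>\<in>\<Omega> n. \<bar>X n \<omega>\<bar> \<le> a * \<rho> n \<and> X n \<omega> \<in> B}"
  have "mass n B = (\<Sum>u\<in>X n ` ?S. \<Sum>\<omega>\<in>{\<omega>\<in>?S. X n \<omega> = u}. q n \<omega> * exp (b * N n / 2 * (X n \<omega>)\<^sup>2))"
    unfolding mass_def by (rule sum.image_gen) simp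
  also have "\<dots> \<le> (\<Sum>u\<in>X n ` ?S. M)"
  proof (rule sum_mono)
    fix u assume u: "u \<in> X n ` ?S"
    then have "{\<omega>\<in>?S. X n \<omega> = u} = {\<omega>\<in>\<Omega> n. X n \<omega> = u}" by auto
    then show "(\<Sum>\<omega>\<in>{\<omega>\<in>?S. X n \<omega> = u}. q n \<omega> * exp (b * N n / 2 * (X n \<omega>)\<^sup>2)) \<le> M"
      using assms(1)[of u] u by auto
  qed
  also have "\<dots> = real (card (X n ` ?S)) * M"
    by simp
  also have "\<dots> \<le> real (card (X n ` \<Omega> n)) * M"
    using assms(2) by (intro mult_right_mono of_nat_mono card_mono) auto
  finally show ?thesis .
qed

lemma err_tendsto: "(\<lambda>n. err n \<xi>) \<longlonglongrightarrow> 0"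
proof -
  have "(\<lambda>n. C * \<bar>\<xi>\<bar> ^ (2 * k + 1) / \<rho> n) \<longlonglongrightarrow> 0"
    by (rule real_tendsto_divide_at_top[OF tendsto_const \<rho>_at_top])
  from tendsto_add[OF tendsto_mult[OF \<delta>_tendsto tendsto_const] this]
  show ?thesis unfolding err_def by simp
qed

lemma err_le:
  assumes "n > 0" "\<bar>\<xi>\<bar> \<le> R"
  shows "err n \<xi> \<le> \<bar>\<delta> n\<bar> * (1 + R ^ (2 * k)) + C * R ^ (2 * k + 1) / \<rho> n"
proof -
  have "\<xi> ^ (2 * k) \<le> R ^ (2 * k)"
    using power_mono[OF assms(2), of "2 * k"] by (simp add: power_even_abs)
  then have "\<delta> n * (1 + \<xi> ^ (2 * k)) \<le> \<bar>\<delta> n\<bar> * (1 + R ^ (2 * k))"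
    by (intro mult_mono) auto
  moreover have "C * \<bar>\<xi>\<bar> ^ (2 * k + 1) / \<rho> n \<le> C * R ^ (2 * k + 1) / \<rho> n"
    using assms \<rho>_pos C_nonneg by (intro divide_right_mono mult_left_mono power_mono) (auto simp: less_imp_le)
  ultimately show ?thesis unfolding err_def by simp
qed

text \<open>Far from the origin only the tilt \<open>b u\<close> is available, because there the remainder of
  \<open>\<Lambda>\<close> is absorbed by its leading term; on bounded sets the remainder is negligible for every tilt,
  and \<open>\<tau> u\<close> gives the sharp rate when \<open>k = 1\<close>.\<close>

lemma mass_upper:
  assumes \<tau>: "\<tau> = b \<or> k = 1"
    and rate: "\<And>u. u \<in> B \<Longrightarrow> c \<le> \<kappa> * (\<tau> * u) ^ (2 * k) - (\<tau> - b)\<^sup>2 * u\<^sup>2 / (2 * b)"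
    and "d < c"
  shows "\<forall>\<^sub>F n in sequentially. mass n B \<le> exp (- \<gamma> n * d)"
proof -
  \<comment> \<open>Half of the gap absorbs the error of the expansion, the other half the number of
    values of \<open>X n\<close>.\<close>
  define \<epsilon> where "\<epsilon> = (c - d) / 2"
  have \<epsilon>: "\<epsilon> > 0" using \<open>d < c\<close> by (simp add: \<epsilon>_def)
  define l where "l = \<kappa> * b ^ (2 * k)"
  have l: "l > 0" using \<kappa>_pos b_pos by (simp add: l_def)
  \<comment> \<open>For \<open>\<bar>u\<bar> > R\<close> one quarter of the leading term
    \<open>l * u ^ (2 * k)\<close> already exceeds \<open>c\<close>; \<open>R \<ge> 1\<close> allows
    \<open>\<bar>u\<bar>\<close> to be bounded by its power.\<close>
  define R where "R = max 1 (4 * \<bar>c\<bar> / l)"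
  define Rt where "Rt = \<bar>\<tau>\<bar> * R"
  have R: "R \<ge> 1" "R * l / 4 \<ge> c"
  proof -
    have "4 * \<bar>c\<bar> / l \<le> R" by (simp add: R_def)
    then show "R * l / 4 \<ge> c" using l by (simp add: field_simps)
  qed (simp add: R_def)
  have Rk: "R \<le> \<bar>u\<bar> ^ (2 * k)" if "\<bar>u\<bar> > R" for u
    using that R(1) k_pos self_le_power[of "\<bar>u\<bar>" "2 * k"] by linarith
  have near: "\<forall>\<^sub>F n in sequentially. \<bar>\<delta> n\<bar> * (1 + Rt ^ (2 * k)) + C * Rt ^ (2 * k + 1) / \<rho> n < \<epsilon>"
  proof (rule order_tendstoD(2)[OF _ \<epsilon>])
    have "(\<lambda>n. \<bar>\<delta> n\<bar> * (1 + Rt ^ (2 * k))) \<longlonglongrightarrow> \<bar>0\<bar> * (1 + Rt ^ (2 * k))"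
      by (intro tendsto_intros \<delta>_tendsto)
    then show "(\<lambda>n. \<bar>\<delta> n\<bar> * (1 + Rt ^ (2 * k)) + C * Rt ^ (2 * k + 1) / \<rho> n) \<longlonglongrightarrow> 0"
      using tendsto_add[OF _ real_tendsto_divide_at_top[OF tendsto_const \<rho>_at_top]] by fastforce
  qed
  have d1: "\<forall>\<^sub>F n in sequentially. \<bar>\<delta> n\<bar> < \<epsilon>" "\<forall>\<^sub>F n in sequentially. \<bar>\<delta> n\<bar> < \<kappa> / 4"
    using tendstoD[OF \<delta>_tendsto, of \<epsilon>] tendstoD[OF \<delta>_tendsto, of "\<kappa> / 4"] \<epsilon> \<kappa>_pos by (auto simp: dist_real_def)
  show ?thesis
    using near d1 card_X[OF \<epsilon>] eventually_gt_at_top[of 0]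
  proof eventually_elim
    case (elim n)
    have g: "\<gamma> n > 0" using \<gamma>_pos elim by blast
    \<comment> \<open>Either both sides are zero because \<open>\<tau> = b\<close>, or
      \<open>k = 1\<close> and the two scales coincide.\<close>
    have eq: "N n * (\<tau> - b)\<^sup>2 = \<gamma> n * (\<tau> - b)\<^sup>2"
      using \<tau> \<gamma>_eq_N[of n] by auto
    have "mass n B \<le> real (card (X n ` \<Omega> n)) * exp (- \<gamma> n * (c - \<epsilon>))"
    proof (rule mass_le_card_mult)
      fix u assume u: "u \<in> B" "\<bar>u\<bar> \<le> a * \<rho> n"
      let ?mass = "\<Sum>\<omega>\<in>{\<omega>\<in>\<Omega> n. X n \<omega> = u}. q n \<omega> * exp (b * N n / 2 * (X n \<omega>)\<^sup>2)"
      show "?mass \<le> exp (- \<gamma> n * (c - \<epsilon>))"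
      proof (cases "\<bar>u\<bar> \<le> R")
        case True
        then have "\<bar>\<tau> * u\<bar> \<le> Rt"
          unfolding Rt_def abs_mult by (intro mult_left_mono) auto
        from err_le[OF _ this] have "err n (\<tau> * u) \<le> \<epsilon>"
          using elim by (meson less_imp_le order_trans)
        then have "c - \<epsilon> \<le> \<kappa> * (\<tau> * u) ^ (2 * k) - (\<tau> - b)\<^sup>2 * u\<^sup>2 / (2 * b) - err n (\<tau> * u)"
          using rate[OF u(1)] by linarith
        then have "\<gamma> n * (c - \<epsilon>)
            \<le> \<gamma> n * (\<kappa> * (\<tau> * u) ^ (2 * k) - (\<tau> - b)\<^sup>2 * u\<^sup>2 / (2 * b) - err n (\<tau> * u))"
          using g by (intro mult_left_mono) auto
        also have "\<dots> = - (N n * (\<tau> - b)\<^sup>2 * u\<^sup>2 / (2 * b)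
            - \<gamma> n * (\<kappa> * (\<tau> * u) ^ (2 * k) - err n (\<tau> * u)))"
          unfolding eq by (simp add: algebra_simps)
        finally have "N n * (\<tau> - b)\<^sup>2 * u\<^sup>2 / (2 * b)
            - \<gamma> n * (\<kappa> * (\<tau> * u) ^ (2 * k) - err n (\<tau> * u)) \<le> - \<gamma> n * (c - \<epsilon>)"
          unfolding mult_minus_left by linarith
        then show ?thesis
          using point_mass_le[OF elim(5), of u \<tau>] by (meson exp_le_cancel_iff order_trans)
      next
        case False
        \<comment> \<open>The conditioning window bounds \<open>\<bar>u\<bar> / \<rho> n\<close> by
          \<open>a\<close>, so by \<open>a_small\<close> the Taylor remainder takes at most half of
          the leading term. The ergodic error takes at most a further quarter plus
          \<open>\<epsilon>\<close>, and the last quarter exceeds \<open>c\<close>.\<close>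
        have "\<bar>b * u\<bar> / \<rho> n \<le> b * a"
          using u(2) \<rho>_pos[of n] b_pos elim by (simp add: abs_mult field_simps)
        then have "C * (b * u) ^ (2 * k) * (\<bar>b * u\<bar> / \<rho> n) \<le> C * (b * u) ^ (2 * k) * (b * a)"
          using C_nonneg by (intro mult_left_mono mult_nonneg_nonneg) auto
        also have "\<dots> = (C * a * b ^ (2 * k + 1)) * u ^ (2 * k)"
          by (simp add: power_mult_distrib)
        also have "\<dots> \<le> l / 2 * u ^ (2 * k)"
          using a_small by (intro mult_right_mono) (auto simp: l_def)
        also have "C * (b * u) ^ (2 * k) * (\<bar>b * u\<bar> / \<rho> n) = C * \<bar>b * u\<bar> ^ (2 * k + 1) / \<rho> n"
          by (simp add: power_even_abs)
        finally have e1: "C * \<bar>b * u\<bar> ^ (2 * k + 1) / \<rho> n \<le> l / 2 * u ^ (2 * k)" .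
        have "\<delta> n * (b * u) ^ (2 * k) \<le> \<kappa> / 4 * (b * u) ^ (2 * k)"
          using elim by (intro mult_right_mono) auto
        then have e2: "\<delta> n * (1 + (b * u) ^ (2 * k)) \<le> \<epsilon> + l / 4 * u ^ (2 * k)"
          using elim by (simp add: algebra_simps power_mult_distrib l_def)
        have "R * l \<le> u ^ (2 * k) * l"
          using Rk[of u] False l by (intro mult_right_mono) (auto simp: power_even_abs)
        then have "c \<le> l / 4 * u ^ (2 * k)"
          using R(2) by (simp add: mult.commute)
        then have "c - \<epsilon> \<le> \<kappa> * (b * u) ^ (2 * k) - err n (b * u)"
          using e1 e2 by (simp add: err_def power_mult_distrib l_def)
        then have "\<gamma> n * (c - \<epsilon>) \<le> \<gamma> n * (\<kappa> * (b * u) ^ (2 * k) - err n (b * u))"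
          using g by (intro mult_left_mono) auto
        then have "N n * (b - b)\<^sup>2 * u\<^sup>2 / (2 * b)
            - \<gamma> n * (\<kappa> * (b * u) ^ (2 * k) - err n (b * u)) \<le> - \<gamma> n * (c - \<epsilon>)"
          by simp
        then show ?thesis
          using point_mass_le[OF elim(5), of u b] by (meson exp_le_cancel_iff order_trans)
      qed
    qed simp
    also have "\<dots> \<le> exp (\<gamma> n * \<epsilon>) * exp (- \<gamma> n * (c - \<epsilon>))"
      using elim by (intro mult_right_mono) auto
    also have "\<dots> = exp (- \<gamma> n * d)"
      unfolding exp_add[symmetric] by (simp add: \<epsilon>_def field_simps)
    finally show ?case .
  qed
qed

text \<open>The coefficient for which \<open>\<Lambda> n \<xi> / N n\<close> tends to
  \<open>v * \<xi>\<^sup>2 / 2\<close>. For \<open>k = 1\<close> the term of order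
  \<open>2 * k\<close> is itself quadratic and contributes \<open>- 2 * \<kappa>\<close>; for
  \<open>k \<ge> 2\<close> it is negligible at the scale \<open>N\<close>. In the application
  \<open>v\<close> is the integral of \<open>L''\<close>.\<close>

definition v :: real where
  "v = (if k = 1 then 1 / b - 2 * \<kappa> else 1 / b)"

lemma \<Lambda>_over_N_tendsto: "(\<lambda>n. \<Lambda> n \<xi> / N n) \<longlonglongrightarrow> v * \<xi>\<^sup>2 / 2"
proof -
  define g where "g = (if k = 1 then 1 else 0 :: real)"
  have g: "(\<lambda>n. \<gamma> n / N n) \<longlonglongrightarrow> g"
  proof (cases "k = 1")
    case True
    have "\<forall>\<^sub>F n in sequentially. \<gamma> n / N n = 1"
      using eventually_gt_at_top[of 0]
      by eventually_elim (use \<gamma>_eq_N[OF True] N_pos in \<open>metis divide_self less_irrefl\<close>)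
    then show ?thesis
      using True by (simp add: g_def tendsto_eventually)
  qed (use \<gamma>_over_N g_def in auto)
  have "(\<lambda>n. \<Lambda> n \<xi> / N n - (\<xi>\<^sup>2 / (2 * b) - \<gamma> n / N n * (\<kappa> * \<xi> ^ (2 * k)))) \<longlonglongrightarrow> 0"
  proof (rule Lim_null_comparison)
    show "(\<lambda>n. \<gamma> n / N n * err n \<xi>) \<longlonglongrightarrow> 0"
      using tendsto_mult[OF g err_tendsto] by simp
    show "\<forall>\<^sub>F n in sequentially. norm (\<Lambda> n \<xi> / N n - (\<xi>\<^sup>2 / (2 * b) - \<gamma> n / N n * (\<kappa> * \<xi> ^ (2 * k))))
        \<le> \<gamma> n / N n * err n \<xi>"
      using eventually_gt_at_top[of 0]
    proof eventually_elim
      case (elim n)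
      have "\<Lambda> n \<xi> / N n - (\<xi>\<^sup>2 / (2 * b) - \<gamma> n / N n * (\<kappa> * \<xi> ^ (2 * k)))
          = (\<Lambda> n \<xi> - (N n * \<xi>\<^sup>2 / (2 * b) - \<gamma> n * (\<kappa> * \<xi> ^ (2 * k)))) / N n"
        using N_pos[OF elim] b_pos by (simp add: field_simps)
      then show ?case
        using \<Lambda>_expansion[OF elim, of \<xi>] N_pos[OF elim]
        by (simp add: err_def abs_divide divide_right_mono)
    qed
  qed
  from tendsto_add[OF this tendsto_diff[OF tendsto_const[of "\<xi>\<^sup>2 / (2 * b)"]
        tendsto_mult[OF g tendsto_const[of "\<kappa> * \<xi> ^ (2 * k)"]]]]
  have "(\<lambda>n. \<Lambda> n \<xi> / N n) \<longlonglongrightarrow> \<xi>\<^sup>2 / (2 * b) - g * (\<kappa> * \<xi> ^ (2 * k))"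
    by simp
  also have "\<xi>\<^sup>2 / (2 * b) - g * (\<kappa> * \<xi> ^ (2 * k)) = v * \<xi>\<^sup>2 / 2"
    by (simp add: g_def v_def field_simps power2_eq_square)
  finally show ?thesis .
qed

text \<open>Under the tilt \<open>\<xi>\<close> the variable is centred at \<open>v * \<xi>\<close>.
  An additional small tilt \<open>s\<close> in the direction \<open>\<sigma>\<close> gives a
  Chernoff bound for either tail; a quarter for each leaves half of the mass near
  \<open>z\<close>.\<close>

lemma tilted_tail_le:
  assumes z: "v * \<xi> = z" and \<eta>: "\<eta> > 0" and \<sigma>: "\<sigma> = 1 \<or> \<sigma> = -1"
  shows "\<forall>\<^sub>F n in sequentially.
    (\<Sum>\<omega>\<in>{\<omega>\<in>\<Omega> n. \<eta> \<le> \<sigma> * (X n \<omega> - z)}. q n \<omega> * exp (\<xi> * N n * X n \<omega>)) \<le> exp (\<Lambda> n \<xi>) / 4"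
proof -
  \<comment> \<open>The quadratic cost \<open>v * s\<^sup>2 / 2\<close> has to stay below the gain
    \<open>s * \<eta>\<close>; the added 1 covers \<open>v = 0\<close>.\<close>
  define s where "s = \<eta> / (\<bar>v\<bar> + 1)"
  have s: "s > 0" using \<eta> by (simp add: s_def add_nonneg_pos)
  have vs: "v * s < \<eta>"
  proof -
    have "v * s < (\<bar>v\<bar> + 1) * s"
      using s by (intro mult_strict_right_mono) auto
    also have "\<dots> = \<eta>" by (simp add: s_def add_nonneg_eq_0_iff)
    finally show ?thesis .
  qed
  define D where "D = s * (\<eta> - v * s / 2)"
  have D: "D > 0"
    using vs \<eta> s by (auto simp: D_def intro!: mult_pos_pos)
  have \<sigma>2: "\<sigma>\<^sup>2 = 1" using \<sigma> by auto
  have "(\<lambda>n. \<Lambda> n (\<xi> + \<sigma> * s) / N n - \<Lambda> n \<xi> / N n - \<sigma> * s * z - s * \<eta>)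
      \<longlonglongrightarrow> v * (\<xi> + \<sigma> * s)\<^sup>2 / 2 - v * \<xi>\<^sup>2 / 2 - \<sigma> * s * z - s * \<eta>"
    by (intro tendsto_diff \<Lambda>_over_N_tendsto tendsto_const)
  also have "v * (\<xi> + \<sigma> * s)\<^sup>2 / 2 - v * \<xi>\<^sup>2 / 2 - \<sigma> * s * z - s * \<eta> = - D"
    unfolding z[symmetric] using \<sigma>2 by (auto simp: D_def field_simps power2_eq_square)
  finally have "\<forall>\<^sub>F n in sequentially.
      \<Lambda> n (\<xi> + \<sigma> * s) / N n - \<Lambda> n \<xi> / N n - \<sigma> * s * z - s * \<eta> < - (D / 2)"
    by (rule order_tendstoD) (use D in simp)
  moreover have "\<forall>\<^sub>F n in sequentially. N n \<ge> 2 * ln 4 / D"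
    using N_at_top by (simp add: filterlim_at_top)
  ultimately show ?thesis
    using eventually_gt_at_top[of 0]
  proof eventually_elim
    case (elim n)
    have N: "N n > 0" using N_pos elim by blast
    let ?S = "{\<omega>\<in>\<Omega> n. \<eta> \<le> \<sigma> * (X n \<omega> - z)}"
    have "(\<Sum>\<omega>\<in>?S. q n \<omega> * exp (\<xi> * N n * X n \<omega>))
        \<le> (\<Sum>\<omega>\<in>?S. q n \<omega> * exp ((\<xi> + \<sigma> * s) * N n * X n \<omega>) * exp (- (\<sigma> * s * z + s * \<eta>) * N n))"
    proof (rule sum_mono)
      fix \<omega> assume \<omega>: "\<omega> \<in> ?S"
      have "0 \<le> s * N n * (\<sigma> * (X n \<omega> - z) - \<eta>)"
        using \<omega> s N by simp
      then have "exp (\<xi> * N n * X n \<omega>) \<le> exp ((\<xi> + \<sigma> * s) * N n * X n \<omega>) * exp (- (\<sigma> * s * z + s * \<eta>) * N n)"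
        unfolding exp_add[symmetric] by (simp add: algebra_simps)
      then show "q n \<omega> * exp (\<xi> * N n * X n \<omega>)
          \<le> q n \<omega> * exp ((\<xi> + \<sigma> * s) * N n * X n \<omega>) * exp (- (\<sigma> * s * z + s * \<eta>) * N n)"
        unfolding mult.assoc[of "q n \<omega>"] using \<omega> q_nonneg by (intro mult_left_mono) auto
    qed
    also have "\<dots> \<le> exp (\<Lambda> n (\<xi> + \<sigma> * s)) * exp (- (\<sigma> * s * z + s * \<eta>) * N n)"
      unfolding sum_distrib_right[symmetric] using elim by (intro mult_right_mono partial_mgf_le) auto
    also have "\<dots> \<le> exp (\<Lambda> n \<xi> - ln 4)"
    proof -
      have "\<Lambda> n (\<xi> + \<sigma> * s) - \<Lambda> n \<xi> - (\<sigma> * s * z + s * \<eta>) * N n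
          = N n * (\<Lambda> n (\<xi> + \<sigma> * s) / N n - \<Lambda> n \<xi> / N n - \<sigma> * s * z - s * \<eta>)"
        using N by (simp add: field_simps)
      also have "\<dots> \<le> N n * (- (D / 2))"
        using N elim by (intro mult_left_mono) auto
      also have "\<dots> \<le> - ln 4"
        using elim D by (simp add: field_simps)
      finally show ?thesis
        unfolding exp_add[symmetric] by (simp add: algebra_simps)
    qed
    also have "\<dots> = exp (\<Lambda> n \<xi>) / 4"
      by (simp add: exp_diff)
    finally show ?case .
  qed
qed

text \<open>Under the tilt \<open>\<tau> z\<close> the variable concentrates at \<open>z\<close>. The quadratic weight is convex, so it
  is bounded below by its tangent; for \<open>\<tau> = b\<close> this tangent cancels the tilt exactly, so nothing is
  lost at the scale \<open>N\<close>.\<close>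

lemma mass_lower:
  assumes \<tau>: "\<tau> = b \<or> k = 1" and z: "v * (\<tau> * z) = z"
    and rate: "\<kappa> * (\<tau> * z) ^ (2 * k) - (\<tau> - b)\<^sup>2 * z\<^sup>2 / (2 * b) < c" and \<eta>: "\<eta> > 0"
  shows "\<forall>\<^sub>F n in sequentially. exp (- \<gamma> n * c) \<le> mass n (ball z \<eta>)"
proof -
  define r where "r = \<kappa> * (\<tau> * z) ^ (2 * k) - (\<tau> - b)\<^sup>2 * z\<^sup>2 / (2 * b)"
  \<comment> \<open>One third each for the error of the expansion, the deviation from
    \<open>z\<close> inside the ball, and the factor 1/2 lost to the tails.\<close>
  define \<epsilon> where "\<epsilon> = (c - r) / 3"
  have \<epsilon>: "\<epsilon> > 0" using rate by (simp add: \<epsilon>_def r_def)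
  \<comment> \<open>On a ball of this radius the linear term
    \<open>(\<tau> - b) * z * (X n \<omega> - z)\<close> is at most
    \<open>\<epsilon>\<close>.\<close>
  define \<theta> where "\<theta> = min \<eta> (\<epsilon> / (\<bar>b - \<tau>\<bar> * \<bar>z\<bar> + 1))"
  have den: "\<bar>b - \<tau>\<bar> * \<bar>z\<bar> + 1 > 0" by (simp add: add_nonneg_pos)
  have \<theta>: "\<theta> > 0" "\<theta> \<le> \<eta>" using \<eta> \<epsilon> den by (auto simp: \<theta>_def)
  have \<theta>2: "\<bar>b - \<tau>\<bar> * \<bar>z\<bar> * \<theta> \<le> \<epsilon>"
  proof -
    have "\<bar>b - \<tau>\<bar> * \<bar>z\<bar> * \<theta> \<le> (\<bar>b - \<tau>\<bar> * \<bar>z\<bar> + 1) * (\<epsilon> / (\<bar>b - \<tau>\<bar> * \<bar>z\<bar> + 1))"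
      using \<theta> by (intro mult_mono) (auto simp: \<theta>_def)
    then show ?thesis using den by simp
  qed
  \<comment> \<open>The first bound puts the ball inside the conditioning window; the second makes
    the factor 1/2 negligible.\<close>
  have "\<forall>\<^sub>F n in sequentially. (\<bar>z\<bar> + \<theta>) / a \<le> \<rho> n" "\<forall>\<^sub>F n in sequentially. ln 2 / \<epsilon> \<le> \<gamma> n"
    using \<rho>_at_top \<gamma>_at_top by (simp_all add: filterlim_at_top)
  moreover have "\<forall>\<^sub>F n in sequentially. err n (\<tau> * z) < \<epsilon>"
    by (rule order_tendstoD(2)[OF err_tendsto \<epsilon>])
  moreover note tilted_tail_le[OF z \<theta>(1), of 1, simplified] tilted_tail_le[OF z \<theta>(1), of "-1", simplified]
  ultimately show ?thesis
    using eventually_gt_at_top[of 0]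
  proof eventually_elim
    case (elim n)
    have N: "N n > 0" "\<gamma> n > 0" using N_pos \<gamma>_pos elim by auto
    let ?w = "\<lambda>\<omega>. q n \<omega> * exp (\<tau> * z * N n * X n \<omega>)"
    let ?S = "{\<omega>\<in>\<Omega> n. X n \<omega> \<in> ball z \<theta>}"
    let ?U = "{\<omega>\<in>\<Omega> n. \<theta> \<le> X n \<omega> - z}" and ?D = "{\<omega>\<in>\<Omega> n. \<theta> \<le> z - X n \<omega>}"
    have "exp (\<Lambda> n (\<tau> * z)) = sum ?w (\<Omega> n)"
      using mgf elim by simp
    also have "\<Omega> n = ?S \<union> (?U \<union> ?D)"
      by (auto simp: dist_real_def)
    also have "sum ?w \<dots> \<le> sum ?w ?S + (sum ?w ?U + sum ?w ?D)"
    proof -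
      have sub: "sum ?w (A \<union> B) \<le> sum ?w A + sum ?w B" if "A \<subseteq> \<Omega> n" "B \<subseteq> \<Omega> n" for A B
      proof -
        have "finite A" "finite B" using that finite_subset[OF _ finite_\<Omega>] by auto
        moreover have "sum ?w (A \<inter> B) \<ge> 0"
          using that q_nonneg by (intro sum_nonneg mult_nonneg_nonneg) auto
        ultimately show ?thesis by (simp add: sum_Un)
      qed
      have "sum ?w (?S \<union> (?U \<union> ?D)) \<le> sum ?w ?S + sum ?w (?U \<union> ?D)"
        by (rule sub) auto
      moreover have "sum ?w (?U \<union> ?D) \<le> sum ?w ?U + sum ?w ?D"
        by (rule sub) auto
      ultimately show ?thesis by linarith
    qed
    finally have conc: "exp (\<Lambda> n (\<tau> * z)) / 2 \<le> sum ?w ?S"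
      using elim(4,5) by linarith
    \<comment> \<open>The constant term of the tangent bound: on the ball,
      \<open>\<tau> * z * N n * X n \<omega> + K\<close> is at most the quadratic exponent.\<close>
    define K where "K = b * N n / 2 * z\<^sup>2 - \<tau> * N n * z\<^sup>2 - \<gamma> n * \<epsilon>"
    have "exp (- \<gamma> n * c) \<le> exp (\<Lambda> n (\<tau> * z) + K - ln 2)"
    proof -
      have "ln 2 \<le> \<gamma> n * \<epsilon>"
        using elim \<epsilon> by (simp add: field_simps)
      moreover have "N n * (\<tau> * z)\<^sup>2 / (2 * b) - \<gamma> n * (\<kappa> * (\<tau> * z) ^ (2 * k)) - \<gamma> n * err n (\<tau> * z)
          \<le> \<Lambda> n (\<tau> * z)"
        using \<Lambda>_expansion[of n "\<tau> * z"] elim by (simp add: err_def abs_le_iff)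
      moreover have "\<gamma> n * err n (\<tau> * z) \<le> \<gamma> n * \<epsilon>"
        using elim N by (intro mult_left_mono) auto
      moreover have "N n * (\<tau> * z)\<^sup>2 / (2 * b) + b * N n / 2 * z\<^sup>2 - \<tau> * N n * z\<^sup>2
          = N n * (\<tau> - b)\<^sup>2 * z\<^sup>2 / (2 * b)"
        using b_pos by (simp add: field_simps power2_eq_square)
      moreover have "N n * (\<tau> - b)\<^sup>2 * z\<^sup>2 / (2 * b) = \<gamma> n * (\<tau> - b)\<^sup>2 * z\<^sup>2 / (2 * b)"
        using \<tau> \<gamma>_eq_N[of n] by auto
      ultimately have "\<gamma> n * (\<tau> - b)\<^sup>2 * z\<^sup>2 / (2 * b) - \<gamma> n * (\<kappa> * (\<tau> * z) ^ (2 * k)) - 3 * (\<gamma> n * \<epsilon>)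
          \<le> \<Lambda> n (\<tau> * z) + K - ln 2"
        unfolding K_def by linarith
      moreover have "\<gamma> n * (\<tau> - b)\<^sup>2 * z\<^sup>2 / (2 * b) - \<gamma> n * (\<kappa> * (\<tau> * z) ^ (2 * k)) - 3 * (\<gamma> n * \<epsilon>)
          = - \<gamma> n * c"
      proof -
        have "\<gamma> n * c = \<gamma> n * r + 3 * (\<gamma> n * \<epsilon>)"
          by (simp add: \<epsilon>_def field_simps)
        moreover have "\<gamma> n * r
            = \<gamma> n * (\<kappa> * (\<tau> * z) ^ (2 * k)) - \<gamma> n * (\<tau> - b)\<^sup>2 * z\<^sup>2 / (2 * b)"
          by (simp only: r_def right_diff_distrib times_divide_eq_right mult.assoc)
        ultimately show ?thesis by linarith
      qed
      ultimately show ?thesis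
        by (subst exp_le_cancel_iff) linarith
    qed
    also have "\<dots> = exp (\<Lambda> n (\<tau> * z)) / 2 * exp K"
      unfolding exp_diff exp_add by simp
    also have "\<dots> \<le> sum ?w ?S * exp K"
      using conc by (intro mult_right_mono) auto
    also have "\<dots> \<le> (\<Sum>\<omega>\<in>?S. q n \<omega> * exp (b * N n / 2 * (X n \<omega>)\<^sup>2))"
      unfolding sum_distrib_right
    proof (rule sum_mono)
      fix \<omega> assume \<omega>: "\<omega> \<in> ?S"
      define h where "h = X n \<omega> - z"
      have h: "\<bar>h\<bar> \<le> \<theta>" using \<omega> by (auto simp: h_def dist_real_def)
      have "N n * ((\<tau> - b) * z * h) = \<gamma> n * ((\<tau> - b) * z * h)"
        using \<tau> \<gamma>_eq_N[of n] by auto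
      also have "\<dots> \<le> \<gamma> n * \<epsilon>"
      proof (intro mult_left_mono)
        have "(\<tau> - b) * z * h \<le> \<bar>b - \<tau>\<bar> * \<bar>z\<bar> * \<bar>h\<bar>"
          by (metis abs_ge_self abs_minus_commute abs_mult)
        also have "\<dots> \<le> \<bar>b - \<tau>\<bar> * \<bar>z\<bar> * \<theta>"
          using h by (intro mult_left_mono) auto
        finally show "(\<tau> - b) * z * h \<le> \<epsilon>" using \<theta>2 by linarith
      qed (use N in simp)
      finally have "N n * ((\<tau> - b) * z * h) \<le> \<gamma> n * \<epsilon> + b * N n / 2 * h\<^sup>2"
        using N b_pos by (simp add: add_increasing2)
      moreover have "b * N n / 2 * (X n \<omega>)\<^sup>2 - \<tau> * z * N n * X n \<omega> - K
          = \<gamma> n * \<epsilon> + b * N n / 2 * h\<^sup>2 - N n * ((\<tau> - b) * z * h)"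
        unfolding K_def h_def by (simp add: field_simps power2_eq_square)
      ultimately have "exp (\<tau> * z * N n * X n \<omega>) * exp K \<le> exp (b * N n / 2 * (X n \<omega>)\<^sup>2)"
        unfolding exp_add[symmetric] by simp
      then show "?w \<omega> * exp K \<le> q n \<omega> * exp (b * N n / 2 * (X n \<omega>)\<^sup>2)"
        unfolding mult.assoc[of "q n \<omega>"] using \<omega> q_nonneg by (intro mult_left_mono) auto
    qed
    also have "\<dots> \<le> mass n (ball z \<eta>)"
      unfolding mass_def
    proof (rule sum_mono2)
      have "\<bar>z\<bar> + \<theta> \<le> a * \<rho> n"
        using elim a_pos by (simp add: field_simps)
      then show "?S \<subseteq> {\<omega> \<in> \<Omega> n. \<bar>X n \<omega>\<bar> \<le> a * \<rho> n \<and> X n \<omega> \<in> ball z \<eta>}"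
        using \<theta>(2) by (auto simp: dist_real_def)
    qed (auto intro!: mult_nonneg_nonneg q_nonneg)
    finally show ?case .
  qed
qed

end

text \<open>It remains to choose the tilt so that the exponent in \<open>mass_upper\<close> and
  \<open>mass_lower\<close> becomes the rate function. The case \<open>k = 1\<close>,
  \<open>v = 0\<close> is separate: there the tilt can be made arbitrarily large and the rate
  degenerates.\<close>

lemma (in quadratic_tilt) LDP_of_mass:
  assumes \<nu>: "\<And>n. n > 0 \<Longrightarrow> mass n UNIV > 0 \<Longrightarrow> prob_space (\<nu> n) \<and> sets (\<nu> n) = sets borel \<and>
      (\<forall>B\<in>sets borel. measure (\<nu> n) B = mass n B / mass n UNIV)"
    and lam: "lam = \<kappa> * b ^ (2 * k) * fact (2 * k)"
    and s2: "sigma2 = 1 / lam - 1 / b" and v_nonneg: "v \<ge> 0"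
  shows "LDP \<nu> \<gamma> (MDP_rate k lam sigma2)"
proof -
  have lam_pos: "lam > 0" using lam \<kappa>_pos b_pos by simp
  define w where "w = v"
  have v1: "w = 1 / b - 2 * \<kappa>" if "k = 1"
    unfolding w_def v_def using that by simp
  \<comment> \<open>For \<open>k = 1\<close> this identifies the degenerate case:
    \<open>sigma2 = 0\<close> exactly when \<open>v = 0\<close>.\<close>
  have s2_v: "sigma2 = b * w / lam" "lam = b - b\<^sup>2 * w" if "k = 1"
  proof -
    have "lam = 2 * \<kappa> * b\<^sup>2" using that lam by (simp add: numeral_2_eq_2)
    then show lam_v: "lam = b - b\<^sup>2 * w"
      using b_pos unfolding v1[OF that] by (simp add: field_simps power2_eq_square)
    have "sigma2 = (b - lam) / (lam * b)"
      using lam_pos b_pos s2 by (simp add: field_simps)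
    also have "b - lam = b * (b * w)"
      unfolding lam_v by (simp add: power2_eq_square)
    finally show "sigma2 = b * w / lam"
      using b_pos by simp
  qed
  show ?thesis
  proof (cases "k = 1 \<and> w = 0")
    case True
    then have rate: "MDP_rate k lam sigma2 z = (if z = 0 then 0 else \<infinity>)" for z
      using s2_v by (simp add: MDP_rate_def)
    have \<kappa>: "\<kappa> = 1 / (2 * b)" using v1 True b_pos by (auto simp: field_simps)
    have lsc: "MDP_rate k lam sigma2 z \<le> Liminf (at z) (MDP_rate k lam sigma2)" for z
    proof (rule Liminf_bounded)
      show "\<forall>\<^sub>F y in at z. MDP_rate k lam sigma2 z \<le> MDP_rate k lam sigma2 y"
      proof (cases "z = 0")
        case False
        have "\<forall>\<^sub>F y in at z. y \<noteq> 0"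
          using False by (rule tendsto_imp_eventually_ne[OF tendsto_ident_at])
        then show ?thesis by eventually_elim (simp add: rate)
      qed (simp add: rate)
    qed
    show ?thesis
    proof (rule LDP_of_normalized_masses[where R = mass, OF \<gamma>_at_top \<nu> _ _ mass_mono mass_nonneg])
      have "{z. (if z = 0 then 0 else \<infinity>) \<le> ereal c} = (if c \<ge> 0 then {0} else {})" for c :: real
        by auto
      then show "good_rate_function (MDP_rate k lam sigma2)"
        unfolding good_rate_function_def using lsc by (auto simp: rate)
    next
      fix F :: "real set" and c assume F: "closed F" and c: "ereal c < (INF z\<in>F. MDP_rate k lam sigma2 z)"
      show "\<forall>\<^sub>F n in sequentially. mass n F \<le> exp (- \<gamma> n * c)"
      \<comment> \<open>If \<open>F\<close> contains 0, the infimum is at most 0, so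
        \<open>c\<close> is negative and the trivial rate bound 0 suffices.\<close>
      proof (cases "0 \<in> F")
        case True
        then have "(INF z\<in>F. MDP_rate k lam sigma2 z) \<le> 0"
          by (intro INF_lower2[of 0]) (auto simp: rate)
        with c have "ereal c < 0" by (rule less_le_trans)
        then have "c < 0" by simp
        then show ?thesis
          using \<kappa>_pos by (intro mass_upper[of b F 0]) auto
      next
        case False
        then obtain d where d: "d > 0" "ball 0 d \<subseteq> - F"
          using F open_contains_ball[of "- F"] by auto
        \<comment> \<open>With \<open>\<kappa> = 1 / (2 * b)\<close> the exponent is
          \<open>(\<tau> - b / 2) * u\<^sup>2\<close>, linear in \<open>\<tau>\<close>; this choice
          pushes it above \<open>c + 1\<close> outside the ball of radius \<open>d\<close>.\<close>
        define \<tau> where "\<tau> = \<bar>c + 1\<bar> / d\<^sup>2 + b / 2"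
        show ?thesis
        proof (rule mass_upper)
          show "\<tau> = b \<or> k = 1" using \<open>k = 1 \<and> w = 0\<close> by simp
          show "c < c + 1" by simp
          fix u assume "u \<in> F"
          then have "d \<le> \<bar>u\<bar>" using d(2) by (force simp: subset_iff not_less[symmetric])
          then have "d\<^sup>2 \<le> u\<^sup>2" using d(1) power_mono[of d "\<bar>u\<bar>" 2] by simp
          then have "\<bar>c + 1\<bar> / d\<^sup>2 * d\<^sup>2 \<le> \<bar>c + 1\<bar> / d\<^sup>2 * u\<^sup>2"
            by (intro mult_left_mono) auto
          then have "c + 1 \<le> (\<tau> - b / 2) * u\<^sup>2" using d(1) by (simp add: \<tau>_def)
          also have "\<dots> = \<kappa> * (\<tau> * u) ^ (2 * k) - (\<tau> - b)\<^sup>2 * u\<^sup>2 / (2 * b)"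
            using \<open>k = 1 \<and> w = 0\<close> b_pos by (simp add: \<kappa> field_simps power2_eq_square)
          finally show "c + 1 \<le> \<kappa> * (\<tau> * u) ^ (2 * k) - (\<tau> - b)\<^sup>2 * u\<^sup>2 / (2 * b)" .
        qed
      qed
    next
      fix z c \<eta> :: real assume z: "MDP_rate k lam sigma2 z < ereal c" and "\<eta> > 0"
      then have "z = 0" "c > 0" by (auto simp: rate split: if_splits)
      then show "\<forall>\<^sub>F n in sequentially. exp (- \<gamma> n * c) \<le> mass n (ball z \<eta>)"
        using k_pos \<open>\<eta> > 0\<close> by (intro mass_lower[of b]) (auto simp: power_0_left)
    qed (simp_all add: rate)
  next
    case False
    \<comment> \<open>For \<open>k = 1\<close> the value \<open>1 / v\<close> maximizes the
      exponent, which is a concave quadratic in \<open>\<tau>\<close>, and it is also the tilt that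
      centres the variable at \<open>z\<close>.\<close>
    define \<tau> where "\<tau> = (if k = 1 then 1 / w else b)"
    define r where "r = (if k = 1 then 1 / (2 * sigma2) else lam / fact (2 * k))"
    have s2_pos: "sigma2 > 0" if "k = 1"
      using s2_v(1)[OF that] False that v_nonneg[folded w_def] lam_pos b_pos by simp
    have r_pos: "r > 0"
      using s2_pos lam_pos by (simp add: r_def)
    have rate: "MDP_rate k lam sigma2 z = ereal (r * z ^ (2 * k))" for z
      using s2_pos by (auto simp: MDP_rate_def r_def)
    have \<tau>: "\<tau> = b \<or> k = 1" by (simp add: \<tau>_def)
    have tilt: "\<kappa> * (\<tau> * z) ^ (2 * k) - (\<tau> - b)\<^sup>2 * z\<^sup>2 / (2 * b) = r * z ^ (2 * k)" for z
    proof (cases "k = 1")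
      case True
      then have v: "w > 0" using False v_nonneg[folded w_def] by simp
      have \<kappa>: "\<kappa> = (1 / b - w) / 2" using v1[OF True] by simp
      have r: "r = 1 / (2 * w) - b / 2"
        using True v b_pos s2_v(2)[OF True] unfolding r_def s2_v(1)[OF True]
        by (simp add: field_simps power2_eq_square)
      show ?thesis
        unfolding \<kappa> r \<tau>_def using True v b_pos by (simp add: field_simps power2_eq_square)
    next
      case False
      then show ?thesis
        by (simp add: \<tau>_def r_def lam power_mult_distrib)
    qed
    have "w = 1 / b" if "k \<noteq> 1"
      unfolding w_def v_def using that by simp
    then have v\<tau>: "v * (\<tau> * z) = z" for z
      unfolding w_def[symmetric] using False b_pos by (auto simp: \<tau>_def)
    show ?thesis
    proof (rule LDP_of_normalized_masses[where R = mass, OF \<gamma>_at_top \<nu> _ _ mass_mono mass_nonneg])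
      show "good_rate_function (MDP_rate k lam sigma2)"
        unfolding good_rate_function_def
      proof (intro conjI allI impI)
        fix z show "0 \<le> MDP_rate k lam sigma2 z"
          using r_pos by (simp add: rate)
        have "(MDP_rate k lam sigma2 \<longlongrightarrow> MDP_rate k lam sigma2 z) (at z)"
          unfolding rate[abs_def] by (intro tendsto_intros)
        then show "MDP_rate k lam sigma2 z \<le> Liminf (at z) (MDP_rate k lam sigma2)"
          by (simp add: lim_imp_Liminf)
      next
        fix c :: real assume "c \<ge> 0"
        have "z \<in> {- (1 + c / r)..1 + c / r}" if "r * z ^ (2 * k) \<le> c" for z
        proof -
          have "\<bar>z\<bar> ^ 1 \<le> 1 + z ^ (2 * k)"
            using k_pos by (intro abs_power_le_1_plus) auto
          also have "z ^ (2 * k) \<le> c / r"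
            using that r_pos by (simp add: field_simps)
          finally show ?thesis by auto
        qed
        then have "bounded {z. r * z ^ (2 * k) \<le> c}"
          by (intro bounded_subset[OF bounded_closed_interval]) blast
        moreover have "closed {z. r * z ^ (2 * k) \<le> c}"
          by (intro closed_Collect_le continuous_intros)
        ultimately show "compact {z. MDP_rate k lam sigma2 z \<le> ereal c}"
          by (simp add: rate compact_eq_bounded_closed)
      qed
    next
      fix F :: "real set" and c assume F: "closed F" and c: "ereal c < (INF z\<in>F. MDP_rate k lam sigma2 z)"
      obtain d where d: "ereal c < ereal d" "ereal d < (INF z\<in>F. MDP_rate k lam sigma2 z)"
        using c ereal_dense2 by blast
      show "\<forall>\<^sub>F n in sequentially. mass n F \<le> exp (- \<gamma> n * c)"
      proof (rule mass_upper[OF \<tau>])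
        show "c < d" using d by simp
        fix u assume "u \<in> F"
        then have "ereal d < MDP_rate k lam sigma2 u"
          using d(2) by (meson INF_lower less_le_trans)
        then show "d \<le> \<kappa> * (\<tau> * u) ^ (2 * k) - (\<tau> - b)\<^sup>2 * u\<^sup>2 / (2 * b)"
          by (simp add: tilt rate)
      qed
    next
      fix z c \<eta> :: real assume "MDP_rate k lam sigma2 z < ereal c" "\<eta> > 0"
      then show "\<forall>\<^sub>F n in sequentially. exp (- \<gamma> n * c) \<le> mass n (ball z \<eta>)"
        by (intro mass_lower[OF \<tau> v\<tau>]) (simp_all add: tilt rate)
    qed (use k_pos in \<open>simp_all add: rate power_0_left\<close>)
  qed
qed

section \<open>The tilted spin system\<close>

lemma spin_config_range: "\<sigma> \<in> spin_configs n \<Longrightarrow> i \<in> {1..n} \<Longrightarrow> \<sigma> i = -1 \<or> \<sigma> i = 1"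
  by (auto simp: spin_configs_def PiE_def Pi_def)

text \<open>Without the interaction the spins are independent, so the generating function factorizes
  over the sites.\<close>

lemma sum_spin_configs_exp_magnetization:
  fixes p :: "nat \<Rightarrow> real"
  shows "(\<Sum>\<sigma>\<in>spin_configs n. (\<Prod>i=1..n. if \<sigma> i = 1 then p i else 1 - p i) * exp (t * magnetization n \<sigma>))
    = (\<Prod>i=1..n. p i * exp t + (1 - p i) * exp (- t))"
proof -
  have "(\<Prod>i=1..n. p i * exp t + (1 - p i) * exp (- t))
      = (\<Prod>i=1..n. \<Sum>\<epsilon>\<in>{-1, 1}. (if \<epsilon> = 1 then p i else 1 - p i) * exp (t * \<epsilon>))"
    by (intro prod.cong refl) auto
  also have "\<dots> = (\<Sum>\<sigma>\<in>spin_configs n. \<Prod>i=1..n. (if \<sigma> i = 1 then p i else 1 - p i) * exp (t * \<sigma> i))"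
    unfolding spin_configs_def by (rule prod_sum_PiE) auto
  also have "\<dots> = (\<Sum>\<sigma>\<in>spin_configs n. (\<Prod>i=1..n. if \<sigma> i = 1 then p i else 1 - p i) * exp (t * magnetization n \<sigma>))"
    by (simp add: magnetization_def prod.distrib exp_sum sum_distrib_left)
  finally show ?thesis ..
qed

text \<open>The magnetization is determined by the number of spins equal to 1.\<close>

lemma card_magnetization_le: "card (magnetization n ` spin_configs n) \<le> n + 1"
proof -
  have "magnetization n \<sigma> \<in> (\<lambda>j. 2 * real j - real n) ` {0..n}" if \<sigma>: "\<sigma> \<in> spin_configs n" for \<sigma>
  proof (rule image_eqI)
    let ?P = "{i\<in>{1..n}. \<sigma> i = 1}"
    have "magnetization n \<sigma> = (\<Sum>i=1..n. 2 * (if \<sigma> i = 1 then 1 else 0) - 1)"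
      unfolding magnetization_def by (intro sum.cong refl) (use spin_config_range[OF \<sigma>] in force)
    also have "\<dots> = 2 * real (card ?P) - real n"
      by (simp add: sum_subtractf sum_distrib_left[symmetric] flip: sum.inter_filter)
    finally show "magnetization n \<sigma> = 2 * real (card ?P) - real n" .
    show "card ?P \<in> {0..n}"
      using card_mono[of "{1..n}" ?P] by fastforce
  qed
  then have "card (magnetization n ` spin_configs n) \<le> card ((\<lambda>j. 2 * real j - real n) ` {0..n})"
    by (intro card_mono) auto
  also have "\<dots> \<le> n + 1"
    using card_image_le[of "{0..n}" "\<lambda>j. 2 * real j - real n"] by simp
  finally show ?thesis .
qed

text \<open>Conditioning cancels the normalizing constant, so only unnormalized weights
  remain.\<close>

lemma distr_uniform_point_measure:
  fixes w :: "'b \<Rightarrow> real" and X :: "'b \<Rightarrow> real"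
  assumes fin: "finite \<Omega>" and w: "\<And>\<sigma>. \<sigma> \<in> \<Omega> \<Longrightarrow> w \<sigma> \<ge> 0" and A: "A \<subseteq> \<Omega>" and pos: "sum w A > 0"
  defines "M \<equiv> point_measure \<Omega> (\<lambda>\<sigma>. ennreal (w \<sigma> / sum w \<Omega>))"
  shows "prob_space (distr (uniform_measure M A) borel X)"
    and "B \<in> sets borel \<Longrightarrow>
      measure (distr (uniform_measure M A) borel X) B = sum w {\<sigma>\<in>A. X \<sigma> \<in> B} / sum w A"
proof -
  have "sum w A \<le> sum w \<Omega>"
    using fin w A by (intro sum_mono2) auto
  with pos have Z: "sum w \<Omega> > 0" by simp
  have meas: "measure M C = sum w C / sum w \<Omega>" if "C \<subseteq> \<Omega>" for C
    unfolding M_def using that fin w Z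
    by (subst measure_point_measure_finite_if) (auto simp: sum_divide_distrib)
  have fm: "emeasure M C \<noteq> \<infinity>" if "C \<subseteq> \<Omega>" for C
    unfolding M_def using that fin w Z
    by (subst emeasure_point_measure_finite) (auto simp: subset_iff sum_ennreal)
  have nz: "emeasure M A \<noteq> 0"
    using meas[OF A] pos Z by (auto simp: measure_def)
  note uni = nz fm[OF A]
  have sets: "sets (uniform_measure M A) = Pow \<Omega>" and sp: "space (uniform_measure M A) = \<Omega>"
    by (simp_all add: M_def sets_point_measure space_point_measure)
  have X: "X \<in> measurable (uniform_measure M A) borel"
    unfolding measurable_def sets sp by auto
  show "prob_space (distr (uniform_measure M A) borel X)"
    by (rule prob_space.prob_space_distr[OF prob_space_uniform_measure[OF uni] X])
  assume B: "B \<in> sets borel"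
  have "measure (distr (uniform_measure M A) borel X) B = measure (uniform_measure M A) (X -` B \<inter> \<Omega>)"
    using measure_distr[OF X B] by (simp only: sp)
  also have "\<dots> = measure M (A \<inter> (X -` B \<inter> \<Omega>)) / measure M A"
    using uni by (intro measure_uniform_measure) (auto simp: M_def sets_point_measure)
  also have "A \<inter> (X -` B \<inter> \<Omega>) = {\<sigma>\<in>A. X \<sigma> \<in> B}"
    using A by auto
  also have "measure M \<dots> / measure M A = sum w {\<sigma>\<in>A. X \<sigma> \<in> B} / sum w A"
    using A Z by (subst (1 2) meas) auto
  finally show "measure (distr (uniform_measure M A) borel X) B = sum w {\<sigma>\<in>A. X \<sigma> \<in> B} / sum w A" .
qed

text \<open>The weights of a product probability measure under which spin \<open>i\<close> has mean
  \<open>tilted_mean (p i) s\<close>.\<close>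

definition spin_tilt :: "(nat \<Rightarrow> real) \<Rightarrow> real \<Rightarrow> nat \<Rightarrow> (nat \<Rightarrow> real) \<Rightarrow> real" where
  "spin_tilt p s n \<sigma> = (\<Prod>i=1..n. if \<sigma> i = 1 then p i else 1 - p i) * exp (s * magnetization n \<sigma>)
     / (\<Prod>i=1..n. p i * exp s + (1 - p i) * exp (- s))"

lemma spin_tilt_nonneg:
  assumes "\<And>i. i \<in> {1..n} \<Longrightarrow> p i \<in> {0..1}"
  shows "spin_tilt p s n \<sigma> \<ge> 0"
  unfolding spin_tilt_def using assms two_point_mgf_pos
  by (intro divide_nonneg_nonneg mult_nonneg_nonneg prod_nonneg) (auto intro: less_imp_le)

lemma spin_tilt_mgf:
  assumes p: "\<And>i. i \<in> {1..n} \<Longrightarrow> p i \<in> {0..1}"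
  shows "(\<Sum>\<sigma>\<in>spin_configs n. spin_tilt p s n \<sigma> * exp (t * (magnetization n \<sigma> - real n * m)))
    = exp ((\<Sum>i=1..n. CW_L (p i) (s + t) - CW_L (p i) s) - real n * m * t)"
proof -
  define D where "D u = (\<Prod>i=1..n. p i * exp u + (1 - p i) * exp (- u))" for u
  have D: "D u = exp (\<Sum>i=1..n. CW_L (p i) u)" for u
    unfolding D_def CW_L_def exp_sum[OF finite_atLeastAtMost] using two_point_mgf_pos p
    by (intro prod.cong refl) auto
  have "(\<Sum>\<sigma>\<in>spin_configs n. spin_tilt p s n \<sigma> * exp (t * (magnetization n \<sigma> - real n * m)))
      = (\<Sum>\<sigma>\<in>spin_configs n. (\<Prod>i=1..n. if \<sigma> i = 1 then p i else 1 - p i)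
          * exp ((s + t) * magnetization n \<sigma>)) * (exp (- (real n * m * t)) / D s)"
    unfolding sum_distrib_right
  proof (intro sum.cong refl)
    fix \<sigma>
    have "exp ((s + t) * magnetization n \<sigma>) * exp (- (real n * m * t))
        = exp (s * magnetization n \<sigma>) * exp (t * (magnetization n \<sigma> - real n * m))"
      unfolding exp_add[symmetric] by (simp add: algebra_simps)
    then show "spin_tilt p s n \<sigma> * exp (t * (magnetization n \<sigma> - real n * m))
      = (\<Prod>i=1..n. if \<sigma> i = 1 then p i else 1 - p i)
          * exp ((s + t) * magnetization n \<sigma>) * (exp (- (real n * m * t)) / D s)"
      unfolding spin_tilt_def D_def[symmetric] by (simp add: mult.assoc)
  qed
  also have "\<dots> = D (s + t) * (exp (- (real n * m * t)) / D s)"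
    unfolding sum_spin_configs_exp_magnetization D_def ..
  also have "\<dots> = exp ((\<Sum>i=1..n. CW_L (p i) (s + t) - CW_L (p i) s) - real n * m * t)"
    unfolding D exp_diff[symmetric] exp_add[symmetric] by (simp add: sum_subtractf)
  finally show ?thesis .
qed

text \<open>Tilting by \<open>\<beta> J m\<close> recentres the quadratic interaction at \<open>n m\<close>.\<close>

lemma gibbs_weight_eq_spin_tilt:
  fixes \<beta> J m :: real
  assumes p: "\<And>i. i \<in> {1..n} \<Longrightarrow> f ((T ^^ i) x) \<in> {0..1}" and n: "n > 0"
  defines "b \<equiv> \<beta> * J"
  obtains K where "K > 0" and "\<And>\<sigma>. gibbs_weight \<beta> J f T n x \<sigma>
    = K * (spin_tilt (\<lambda>i. f ((T ^^ i) x)) (b * m) n \<sigma>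
        * exp (b * (magnetization n \<sigma> - real n * m)\<^sup>2 / (2 * real n)))"
proof
  define D where "D = (\<Prod>i=1..n. f ((T ^^ i) x) * exp (b * m) + (1 - f ((T ^^ i) x)) * exp (- (b * m)))"
  have D: "D > 0"
    unfolding D_def using two_point_mgf_pos p by (intro prod_pos) auto
  show "D * exp (- (b * real n * m\<^sup>2 / 2)) > 0"
    using D by simp
  fix \<sigma>
  let ?M = "magnetization n \<sigma>"
  \<comment> \<open>Completing the square around \<open>n m\<close>; the part independent of
    \<open>\<sigma>\<close> goes into the constant.\<close>
  have "\<beta> * J / (2 * real n) * ?M\<^sup>2
      = b * m * ?M + b * (?M - real n * m)\<^sup>2 / (2 * real n) - b * real n * m\<^sup>2 / 2"
    using n by (simp add: b_def field_simps power2_eq_square)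
  then have "exp (\<beta> * J / (2 * real n) * ?M\<^sup>2) = exp (b * m * ?M)
      * exp (b * (?M - real n * m)\<^sup>2 / (2 * real n)) * exp (- (b * real n * m\<^sup>2 / 2))"
    unfolding exp_add[symmetric] by simp
  then show "gibbs_weight \<beta> J f T n x \<sigma> = D * exp (- (b * real n * m\<^sup>2 / 2)) *
      (spin_tilt (\<lambda>i. f ((T ^^ i) x)) (b * m) n \<sigma> * exp (b * (?M - real n * m)\<^sup>2 / (2 * real n)))"
    unfolding gibbs_weight_def spin_tilt_def D_def[symmetric] using D by simp
qed

text \<open>The Taylor polynomial is split into means \<open>c j\<close> and fluctuations
  \<open>S j\<close>. With \<open>c j\<close> the integral of the derivative of order
  \<open>j\<close>, hypothesis \<open>c\<close> says that the derivatives of \<open>G\<close> at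
  \<open>m\<close> vanish below order \<open>2 * k\<close> and equal \<open>lam\<close> there, so
  the means contribute only a linear, a quadratic and a \<open>lam\<close> term. The linear one is
  cancelled by the centring.\<close>

lemma cumulant_expansion:
  fixes p :: "nat \<Rightarrow> real" and b lam m \<alpha> C \<xi> :: real and c :: "nat \<Rightarrow> real" and k n :: nat
  assumes p: "\<And>i. i \<in> {1..n} \<Longrightarrow> p i \<in> {0..1}" and b: "b > 0" and k: "k \<ge> 1" and n: "n > 0"
    and \<alpha>: "1 - 1 / (2 * real k) < \<alpha>"
    and C: "\<And>\<phi> s. \<phi> \<in> {0..1} \<Longrightarrow> \<bar>(deriv ^^ Suc (2 * k)) (CW_L \<phi>) s\<bar> \<le> C"
    and c: "\<And>j. j \<in> {1..2 * k} \<Longrightarrow>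
      b ^ j * c j = (if j = 1 then b * m else if j = 2 then b else 0) - (if j = 2 * k then lam else 0)"
  defines "S j \<equiv> \<Sum>i=1..n. (deriv ^^ j) (CW_L (p i)) (b * m) - c j"
    and "t \<equiv> \<xi> * real n powr (\<alpha> - 1)" and "g \<equiv> real n powr (1 - 2 * real k + 2 * real k * \<alpha>)"
  shows "\<bar>(\<Sum>i=1..n. CW_L (p i) (b * m + t) - CW_L (p i) (b * m)) - real n * m * t
      - (real n powr (2 * \<alpha> - 1) * \<xi>\<^sup>2 / (2 * b) - g * (lam / (b ^ (2 * k) * fact (2 * k)) * \<xi> ^ (2 * k)))\<bar>
    \<le> g * ((\<Sum>j=1..2 * k. \<bar>S j\<bar> / real n powr (real j / real (2 * k))) * (1 + \<xi> ^ (2 * k))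
        + C * \<bar>\<xi>\<bar> ^ (2 * k + 1) / real n powr (1 - \<alpha>))"
proof -
  let ?L = "\<lambda>j i. (deriv ^^ j) (CW_L (p i)) (b * m)"
  have n1: "real n \<ge> 1" using n by simp
  have t_pow: "\<bar>t\<bar> ^ j = \<bar>\<xi>\<bar> ^ j * real n powr (real j * (\<alpha> - 1))" for j
    unfolding t_def by (simp add: abs_mult power_mult_distrib powr_power n mult.commute)
  have g_eq: "g = real n * real n powr (real (2 * k) * (\<alpha> - 1))"
    using n1 unfolding g_def by (subst powr_mult_base) (auto simp: algebra_simps)
  have main: "real n * (\<Sum>j=1..2 * k. c j / fact j * t ^ j) - real n * m * t
      = real n powr (2 * \<alpha> - 1) * \<xi>\<^sup>2 / (2 * b) - g * (lam / (b ^ (2 * k) * fact (2 * k)) * \<xi> ^ (2 * k))"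
  proof -
    have "(\<Sum>j=1..2 * k. c j / fact j * t ^ j)
        = (\<Sum>j=1..2 * k. (if j = 1 then m * t else 0) + (if j = 2 then t\<^sup>2 / (2 * b) else 0)
            - (if j = 2 * k then lam / (b ^ (2 * k) * fact (2 * k)) * t ^ (2 * k) else 0))"
    proof (intro sum.cong refl)
      fix j assume j: "j \<in> {1..2 * k}"
      have "c j = ((if j = 1 then b * m else if j = 2 then b else 0) - (if j = 2 * k then lam else 0)) / b ^ j"
        using c[OF j] b by (simp add: field_simps)
      then have "c j / fact j * t ^ j = (if j = 1 then b * m else if j = 2 then b else 0) / b ^ j / fact j * t ^ j
          - (if j = 2 * k then lam else 0) / b ^ j / fact j * t ^ j"
        by (simp only: diff_divide_distrib left_diff_distrib)
      also have "(if j = 1 then b * m else if j = 2 then b else 0) / b ^ j / fact j * t ^ j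
          = (if j = 1 then m * t else 0) + (if j = 2 then t\<^sup>2 / (2 * b) else 0)"
        using b by (simp add: power2_eq_square)
      also have "(if j = 2 * k then lam else 0) / b ^ j / fact j * t ^ j
          = (if j = 2 * k then lam / (b ^ (2 * k) * fact (2 * k)) * t ^ (2 * k) else 0)"
        by simp
      finally show "c j / fact j * t ^ j = (if j = 1 then m * t else 0) + (if j = 2 then t\<^sup>2 / (2 * b) else 0)
            - (if j = 2 * k then lam / (b ^ (2 * k) * fact (2 * k)) * t ^ (2 * k) else 0)" .
    qed
    also have "\<dots> = m * t + t\<^sup>2 / (2 * b) - lam / (b ^ (2 * k) * fact (2 * k)) * t ^ (2 * k)"
      using k by (simp add: sum.distrib sum_subtractf)
    finally have sum_eq: "(\<Sum>j=1..2 * k. c j / fact j * t ^ j)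
        = m * t + t\<^sup>2 / (2 * b) - lam / (b ^ (2 * k) * fact (2 * k)) * t ^ (2 * k)" .
    have "real n * (\<Sum>j=1..2 * k. c j / fact j * t ^ j) - real n * m * t
        = (real n * t\<^sup>2) / (2 * b) - lam / (b ^ (2 * k) * fact (2 * k)) * (real n * t ^ (2 * k))"
      unfolding sum_eq by (simp add: algebra_simps)
    moreover have "real n * t\<^sup>2 = real n powr (2 * \<alpha> - 1) * \<xi>\<^sup>2"
    proof -
      have "real n * real n powr (2 * (\<alpha> - 1)) = real n powr (2 * \<alpha> - 1)"
        using n1 by (subst powr_mult_base) (auto simp: algebra_simps)
      then show ?thesis
        using t_pow[of 2] by simp
    qed
    moreover have "real n * t ^ (2 * k) = g * \<xi> ^ (2 * k)"
      unfolding g_eq using t_pow[of "2 * k"] by (simp add: power_even_abs)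
    ultimately show ?thesis by simp
  qed
  have taylor: "\<bar>(CW_L (p i) (b * m + t) - CW_L (p i) (b * m)) - (\<Sum>j=1..2 * k. ?L j i / fact j * t ^ j)\<bar>
      \<le> C * \<bar>t\<bar> ^ Suc (2 * k)" if i: "i \<in> {1..n}" for i
  proof -
    have "{..2 * k} = insert 0 {1..2 * k}" by auto
    then have "(\<Sum>j\<le>2 * k. ?L j i / fact j * t ^ j) = CW_L (p i) (b * m) + (\<Sum>j=1..2 * k. ?L j i / fact j * t ^ j)"
      by simp
    then show ?thesis
      using taylor_abs_le[of "\<lambda>j. (deriv ^^ j) (CW_L (p i))" "2 * k" C "b * m" t,
          OF has_real_derivative_deriv_funpow_CW_L[OF p[OF i]] C[OF p[OF i]]]
      by (simp add: diff_diff_eq)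
  qed
  have fluct: "\<bar>S j / fact j * t ^ j\<bar>
      \<le> g * (\<bar>S j\<bar> / real n powr (real j / real (2 * k)) * (1 + \<xi> ^ (2 * k)))" if j: "j \<in> {1..2 * k}" for j
  proof -
    have e: "1 - 2 * real k + 2 * real k * \<alpha> \<ge> 0"
      using \<alpha> k by (simp add: field_simps)
    \<comment> \<open>The exponent is the fraction \<open>j / (2 * k)\<close> of that of the speed,
      which is nonnegative by the lower bound on \<open>\<alpha>\<close>. Hence fluctuations of size
      \<open>o(n powr (j / (2 * k)))\<close> are negligible at every order.\<close>
    have "real j / real (2 * k) + real j * (\<alpha> - 1)
        = real j / real (2 * k) * (1 - 2 * real k + 2 * real k * \<alpha>)"
      using k by (simp add: field_simps)
    also have "\<dots> \<le> 1 * (1 - 2 * real k + 2 * real k * \<alpha>)"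
      using j k by (intro mult_right_mono e) (auto simp: field_simps)
    finally have "real n powr (real j / real (2 * k) + real j * (\<alpha> - 1)) \<le> g"
      unfolding g_def using n1 by (intro powr_mono) auto
    then have pw: "real n powr (real j * (\<alpha> - 1)) \<le> g / real n powr (real j / real (2 * k))"
      using n unfolding powr_add by (simp add: pos_le_divide_eq mult.commute)
    have "\<bar>S j / fact j * t ^ j\<bar> = \<bar>S j\<bar> / fact j * (\<bar>\<xi>\<bar> ^ j * real n powr (real j * (\<alpha> - 1)))"
      using t_pow[of j] by (simp add: abs_mult power_abs)
    also have "\<dots> \<le> \<bar>S j\<bar> * ((1 + \<xi> ^ (2 * k)) * (g / real n powr (real j / real (2 * k))))"
    proof (intro mult_mono)
      show "\<bar>S j\<bar> / fact j \<le> \<bar>S j\<bar>"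
        using fact_ge_1[of j, where 'a = real] by (simp add: divide_le_eq mult_le_cancel_left1)
      show "\<bar>\<xi>\<bar> ^ j \<le> 1 + \<xi> ^ (2 * k)"
        using j by (intro abs_power_le_1_plus) auto
    qed (use pw in \<open>auto intro!: add_nonneg_nonneg\<close>)
    finally show ?thesis by (simp add: ac_simps)
  qed
  \<comment> \<open>\<open>E1\<close> collects the Taylor remainders, \<open>E2\<close> the ergodic
    fluctuations.\<close>
  define E1 where "E1 = (\<Sum>i=1..n. (CW_L (p i) (b * m + t) - CW_L (p i) (b * m)) - (\<Sum>j=1..2 * k. ?L j i / fact j * t ^ j))"
  define E2 where "E2 = (\<Sum>j=1..2 * k. S j / fact j * t ^ j)"
  have "(\<Sum>i=1..n. \<Sum>j=1..2 * k. ?L j i / fact j * t ^ j)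
      = (\<Sum>j=1..2 * k. (S j + real n * c j) / fact j * t ^ j)"
    by (subst sum.swap) (simp add: S_def sum_subtractf sum_distrib_right sum_divide_distrib)
  also have "\<dots> = E2 + real n * (\<Sum>j=1..2 * k. c j / fact j * t ^ j)"
    unfolding E2_def sum_distrib_left sum.distrib[symmetric]
    by (intro sum.cong refl) (simp add: add_divide_distrib distrib_right)
  finally have split: "(\<Sum>i=1..n. CW_L (p i) (b * m + t) - CW_L (p i) (b * m))
      = E1 + E2 + real n * (\<Sum>j=1..2 * k. c j / fact j * t ^ j)"
    unfolding E1_def sum_subtractf by simp
  have "\<bar>E1\<bar> \<le> (\<Sum>i=1..n. C * \<bar>t\<bar> ^ Suc (2 * k))"
    unfolding E1_def by (intro order_trans[OF sum_abs] sum_mono taylor)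
  also have "\<dots> = g * (C * \<bar>\<xi>\<bar> ^ (2 * k + 1) / real n powr (1 - \<alpha>))"
  proof -
    have "real n powr (real (2 * k + 1) * (\<alpha> - 1))
        = real n powr (real (2 * k) * (\<alpha> - 1)) / real n powr (1 - \<alpha>)"
      unfolding powr_diff[symmetric] by (simp add: algebra_simps)
    then show ?thesis
      using t_pow[of "2 * k + 1"] unfolding g_eq by simp
  qed
  finally have "\<bar>E1\<bar> \<le> g * (C * \<bar>\<xi>\<bar> ^ (2 * k + 1) / real n powr (1 - \<alpha>))" .
  moreover have "\<bar>E2\<bar> \<le> g * ((\<Sum>j=1..2 * k. \<bar>S j\<bar> / real n powr (real j / real (2 * k))) * (1 + \<xi> ^ (2 * k)))"
    unfolding E2_def sum_distrib_right sum_distrib_left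
    by (intro order_trans[OF sum_abs] sum_mono fluct)
  ultimately show ?thesis
    unfolding split main[symmetric] distrib_left by linarith
qed

section \<open>Application to the Curie-Weiss model\<close>

lemma filterlim_nat_powr_at_top:
  assumes "e > 0"
  shows "filterlim (\<lambda>n. real n powr e) at_top sequentially"
  using assms by real_asymp

lemma eventually_Suc_le_exp_powr:
  assumes "e > 0" "\<epsilon> > 0"
  shows "\<forall>\<^sub>F n in sequentially. real n + 1 \<le> exp (real n powr e * \<epsilon>)"
  using assms by real_asymp

theorem theorem1p4:
  fixes \<mu> :: "'a measure" and T :: "'a \<Rightarrow> 'a" and f :: "'a \<Rightarrow> real"
    and \<beta> J m lam sigma2 :: real and k :: nat
  assumes "dynamical_system \<mu> T"
    and "f \<in> borel_measurable \<mu>" and "\<And>y. y \<in> space \<mu> \<Longrightarrow> f y \<in> {0..1}"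
    and "\<beta> > 0" and "J > 0"
    and "local_minimum (CW_G \<beta> J \<mu> f) m"
    and "has_type (CW_G \<beta> J \<mu> f) m (2 * k)"
    and "lam = (deriv ^^ (2 * k)) (CW_G \<beta> J \<mu> f) m"
    and "\<And>j. j \<in> {1..2 * k} \<Longrightarrow>
           (\<lambda>y. (deriv ^^ j) (CW_L (f y)) (\<beta> * J * m))
             \<in> ergodic_class \<mu> T (real j / real (2 * k))"
    and "sigma2 = 1 / lam - 1 / (\<beta> * J)"
  shows "\<exists>A>0. \<forall>x\<in>space \<mu>. \<forall>a \<alpha>.
           0 < a \<and> a < A \<and> 1 - 1 / (2 * real k) < \<alpha> \<and> \<alpha> < 1 \<longrightarrow>
           LDP (\<lambda>n. conditional_law \<beta> J f T x m a \<alpha> n)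
               (\<lambda>n. real n powr (1 - 2 * real k + 2 * real k * \<alpha>))
               (MDP_rate k lam sigma2)"
proof -
  interpret dynamical_system \<mu> T by fact
  define b where "b = \<beta> * J"
  have b: "b > 0" using assms(4,5) by (simp add: b_def)
  have k: "k \<ge> 1" using assms(7) by (simp add: has_type_def)
  have G_deriv: "(deriv ^^ j) (CW_G \<beta> J \<mu> f) = CW_G_deriv \<mu> f b j" for j
    unfolding b_def by (rule deriv_funpow_CW_G[OF assms(2,3)])
  have G0: "CW_G_deriv \<mu> f b j m = (if j = 2 * k then lam else 0)" if "j \<in> {1..2 * k}" for j
    using assms(7,8) that unfolding has_type_def G_deriv by auto
  have lam_eq: "lam = CW_G_deriv \<mu> f b (2 * k) m"
    using assms(8) by (simp add: G_deriv)
  have "CW_G_deriv \<mu> f b (2 * k) m > 0"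
  proof (rule local_minimum_deriv_pos[where g = "CW_G_deriv \<mu> f b"])
    show "local_minimum (CW_G_deriv \<mu> f b 0) m"
      using assms(6) G_deriv[of 0] by simp
    show "CW_G_deriv \<mu> f b (2 * k) m \<noteq> 0"
      using assms(7) by (simp add: has_type_def G_deriv)
    show "CW_G_deriv \<mu> f b j m = 0" if "1 \<le> j" "j < 2 * k" for j
      using G0[of j] that by simp
  qed (use has_real_derivative_CW_G_deriv[OF assms(2,3)] k in auto)
  then have lam: "lam > 0" by (simp add: lam_eq)
  obtain C where C: "C > 0" "\<And>\<phi> s. \<phi> \<in> {0..1} \<Longrightarrow> \<bar>(deriv ^^ Suc (2 * k)) (CW_L \<phi>) s\<bar> \<le> C"
    using deriv_funpow_CW_L_bounded[of "2 * k"] by metis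
  define c where "c j = (\<integral>y. (deriv ^^ j) (CW_L (f y)) (b * m) \<partial>\<mu>)" for j
  \<comment> \<open>The conditions on the derivatives of \<open>G\<close> at \<open>m\<close>,
    solved for the integrals of the derivatives of \<open>L\<close>.\<close>
  have c: "b ^ j * c j = (if j = 1 then b * m else if j = 2 then b else 0) - (if j = 2 * k then lam else 0)"
    if j: "j \<in> {1..2 * k}" for j
    using G0[OF j] j by (simp add: CW_G_deriv_def c_def)
  define \<kappa> where "\<kappa> = lam / (b ^ (2 * k) * fact (2 * k))"
  have \<kappa>: "\<kappa> > 0" using lam b by (simp add: \<kappa>_def)
  \<comment> \<open>Chosen so that \<open>a < A\<close> implies \<open>a_small\<close>; it depends
    neither on \<open>x\<close> nor on \<open>\<alpha>\<close>.\<close>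
  define A where "A = \<kappa> / (2 * C * b)"
  have "A > 0" using \<kappa> C(1) b by (simp add: A_def)
  moreover have "LDP (conditional_law \<beta> J f T x m a \<alpha>) (\<lambda>n. real n powr (1 - 2 * real k + 2 * real k * \<alpha>))
      (MDP_rate k lam sigma2)"
    if x: "x \<in> space \<mu>" and a: "0 < a" "a < A" and \<alpha>: "1 - 1 / (2 * real k) < \<alpha>" "\<alpha> < 1" for x a \<alpha>
  proof -
    define p where "p i = f ((T ^^ i) x)" for i
    have orbit: "(T ^^ i) x \<in> space \<mu>" for i
      using x measurable_space[OF measurable_map] by (induction i) auto
    then have p: "p i \<in> {0..1}" for i
      using assms(3) unfolding p_def by blast
    define S where "S j n = (\<Sum>i=1..n. (deriv ^^ j) (CW_L (p i)) (b * m) - c j)" for j n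
    define e where "e = 1 - 2 * real k + 2 * real k * \<alpha>"
    define \<delta> where "\<delta> n = (\<Sum>j=1..2 * k. \<bar>S j n\<bar> / real n powr (real j / real (2 * k)))" for n
    define X where "X n \<sigma> = (magnetization n \<sigma> - real n * m) / real n powr \<alpha>" for n \<sigma>
    define \<Lambda> where "\<Lambda> n \<xi> = (\<Sum>i=1..n. CW_L (p i) (b * m + \<xi> * real n powr (\<alpha> - 1)) - CW_L (p i) (b * m))
      - real n * m * (\<xi> * real n powr (\<alpha> - 1))" for n \<xi>
    have e_pos: "e > 0" using \<alpha> k by (simp add: e_def field_simps)
    \<comment> \<open>\<open>\<alpha> > 1 / 2\<close> makes the scale
      \<open>n powr (2 * \<alpha> - 1)\<close> diverge.\<close>
    have "1 / (2 * real k) \<le> 1 / 2" using k by (intro divide_left_mono) auto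
    then have \<alpha>_half: "\<alpha> > 1 / 2" using \<alpha> by linarith
    \<comment> \<open>The ergodic hypothesis enters here, at the given point \<open>x\<close> of the
      space.\<close>
    have \<delta>: "\<delta> \<longlonglongrightarrow> 0"
      unfolding \<delta>_def
    proof (rule tendsto_null_sum)
      fix j assume "j \<in> {1..2 * k}"
      then have "(\<lambda>n. \<bar>S j n\<bar>) \<in> o(\<lambda>n. real n powr (real j / real (2 * k)))"
        using assms(9)[of j] x unfolding ergodic_class_def S_def p_def c_def b_def by auto
      then show "(\<lambda>n. \<bar>S j n\<bar> / real n powr (real j / real (2 * k))) \<longlonglongrightarrow> 0"
        by (rule smalloD_tendsto)
    qed
    interpret quadratic_tilt spin_configs "spin_tilt p (b * m)" X "\<lambda>n. real n powr (2 * \<alpha> - 1)"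
      "\<lambda>n. real n powr e" "\<lambda>n. real n powr (1 - \<alpha>)" \<delta> \<Lambda> a b \<kappa> C k
    proof
      show "spin_tilt p (b * m) n \<sigma> \<ge> 0" for n \<sigma>
        using p by (intro spin_tilt_nonneg)
      have "C * a * b ^ (2 * k + 1) \<le> C * A * b ^ (2 * k + 1)"
        using a C b by (intro mult_right_mono mult_left_mono) auto
      also have "\<dots> = \<kappa> * b ^ (2 * k) / 2"
        using C(1) b by (simp add: A_def)
      finally show "C * a * b ^ (2 * k + 1) \<le> \<kappa> * b ^ (2 * k) / 2" .
      show "real n powr e = real n powr (2 * \<alpha> - 1)" if "k = 1" for n
        using that by (simp add: e_def)
      show "(\<lambda>n. real n powr e / real n powr (2 * \<alpha> - 1)) \<longlonglongrightarrow> 0" if "k \<noteq> 1"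
      proof -
        \<comment> \<open>For \<open>k \<ge> 2\<close> the speed is of smaller order than the
          quadratic scale precisely because \<open>\<alpha> < 1\<close>.\<close>
        have "e - (2 * \<alpha> - 1) = - ((2 * real k - 2) * (1 - \<alpha>))"
          by (simp add: e_def algebra_simps)
        moreover have "(2 * real k - 2) * (1 - \<alpha>) > 0"
          using that k \<alpha> by (intro mult_pos_pos) auto
        ultimately have "e - (2 * \<alpha> - 1) < 0" by simp
        then show ?thesis
          unfolding powr_diff[symmetric] by (rule tendsto_neg_powr[OF _ filterlim_real_sequentially])
      qed
      show "\<forall>\<^sub>F n in sequentially. real (card (X n ` spin_configs n)) \<le> exp (real n powr e * \<epsilon>)"
        if "\<epsilon> > 0" for \<epsilon>
        using eventually_Suc_le_exp_powr[OF e_pos that]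
      proof eventually_elim
        case (elim n)
        have "X n ` spin_configs n = (\<lambda>M. (M - real n * m) / real n powr \<alpha>) ` magnetization n ` spin_configs n"
          by (auto simp: X_def image_image)
        then have "card (X n ` spin_configs n) \<le> card (magnetization n ` spin_configs n)"
          by (simp add: card_image_le)
        also have "\<dots> \<le> n + 1" by (rule card_magnetization_le)
        finally show ?case using elim by linarith
      qed
      show "(\<Sum>\<sigma>\<in>spin_configs n. spin_tilt p (b * m) n \<sigma> * exp (\<xi> * real n powr (2 * \<alpha> - 1) * X n \<sigma>))
          = exp (\<Lambda> n \<xi>)" if n: "n > 0" for n \<xi>
      proof -
        have scale: "\<xi> * real n powr (2 * \<alpha> - 1) * X n \<sigma>
            = \<xi> * real n powr (\<alpha> - 1) * (magnetization n \<sigma> - real n * m)" for \<sigma>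
        proof -
          have "real n powr (2 * \<alpha> - 1) = real n powr (\<alpha> - 1) * real n powr \<alpha>"
            unfolding powr_add[symmetric] by (simp add: algebra_simps)
          then show ?thesis using n by (simp add: X_def)
        qed
        show ?thesis
          unfolding scale \<Lambda>_def by (rule spin_tilt_mgf) (rule p)
      qed
      show "\<bar>\<Lambda> n \<xi> - (real n powr (2 * \<alpha> - 1) * \<xi>\<^sup>2 / (2 * b) - real n powr e * (\<kappa> * \<xi> ^ (2 * k)))\<bar>
          \<le> real n powr e * (\<delta> n * (1 + \<xi> ^ (2 * k)) + C * \<bar>\<xi>\<bar> ^ (2 * k + 1) / real n powr (1 - \<alpha>))"
        if "n > 0" for n \<xi>
        unfolding \<Lambda>_def \<delta>_def S_def e_def \<kappa>_def
        by (rule cumulant_expansion[OF p b k that \<alpha>(1) C(2) c])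
    qed (use b \<kappa> k C(1) a \<delta> e_pos \<alpha>_half \<alpha> filterlim_nat_powr_at_top in auto)
    have "v \<ge> 0"
    proof (cases "k = 1")
      case True
      have "c 2 \<ge> 0"
        unfolding c_def by (intro integral_nonneg_AE AE_I2 deriv2_CW_L_nonneg assms(3))
      \<comment> \<open>So for \<open>k = 1\<close> the constant \<open>v\<close> is an average of
        spin variances, hence nonnegative.\<close>
      moreover have "1 / b - 2 * \<kappa> = c 2"
        unfolding \<kappa>_def using c[of 2] True b by (simp add: field_simps power2_eq_square)
      ultimately show ?thesis
        unfolding v_def using True by simp
    qed (use b in \<open>simp add: v_def\<close>)
    moreover have "prob_space (conditional_law \<beta> J f T x m a \<alpha> n) \<and>
        sets (conditional_law \<beta> J f T x m a \<alpha> n) = sets borel \<and>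
        (\<forall>B\<in>sets borel. measure (conditional_law \<beta> J f T x m a \<alpha> n) B = mass n B / mass n UNIV)"
      if n: "n > 0" and pos: "mass n UNIV > 0" for n
    proof -
      let ?w = "gibbs_weight \<beta> J f T n x"
      let ?E = "{\<sigma> \<in> spin_configs n. magnetization n \<sigma> / real n \<in> {m - a..m + a}}"
      obtain K where K: "K > 0" and w: "\<And>\<sigma>. ?w \<sigma> = K * (spin_tilt p (b * m) n \<sigma>
          * exp (b * (magnetization n \<sigma> - real n * m)\<^sup>2 / (2 * real n)))"
        using gibbs_weight_eq_spin_tilt[of n f T x \<beta> J m] p n unfolding p_def b_def by metis
      have sq: "b * (magnetization n \<sigma> - real n * m)\<^sup>2 / (2 * real n)
          = b * real n powr (2 * \<alpha> - 1) / 2 * (X n \<sigma>)\<^sup>2" for \<sigma>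
      proof -
        have "real n powr (2 * \<alpha> - 1) = (real n powr \<alpha>)\<^sup>2 / real n"
          using n by (simp add: powr_diff powr_power mult.commute)
        then show ?thesis using n by (simp add: X_def power_divide)
      qed
      have E: "magnetization n \<sigma> / real n \<in> {m - a..m + a} \<longleftrightarrow> \<bar>X n \<sigma>\<bar> \<le> a * real n powr (1 - \<alpha>)" for \<sigma>
      proof -
        have "real n powr (1 - \<alpha>) = real n / real n powr \<alpha>"
          using n by (simp add: powr_diff)
        then have "\<bar>X n \<sigma>\<bar> \<le> a * real n powr (1 - \<alpha>) \<longleftrightarrow> \<bar>magnetization n \<sigma> - real n * m\<bar> \<le> a * real n"
          using n by (simp add: X_def abs_divide divide_le_cancel)
        then show ?thesis
          using n by (auto simp: abs_le_iff field_simps)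
      qed
      \<comment> \<open>The constant \<open>K\<close> does not depend on the configuration and
        cancels in the conditional law.\<close>
      have mass: "sum ?w {\<sigma> \<in> ?E. X n \<sigma> \<in> B} = K * mass n B" for B
        unfolding mass_def w sum_distrib_left[symmetric] sq E by (simp add: conj_ac)
      have "sum ?w ?E > 0"
        using mass[of UNIV] pos K by simp
      moreover have "?w \<sigma> \<ge> 0" for \<sigma>
        using w K spin_tilt_nonneg[of n p] p by simp
      ultimately have *: "prob_space (conditional_law \<beta> J f T x m a \<alpha> n)"
        "\<And>B. B \<in> sets borel \<Longrightarrow> measure (conditional_law \<beta> J f T x m a \<alpha> n) B
          = sum ?w {\<sigma> \<in> ?E. X n \<sigma> \<in> B} / sum ?w ?E"
        using distr_uniform_point_measure[where X = "X n", of "spin_configs n" ?w ?E]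
        unfolding conditional_law_def gibbs_measure_def X_def[abs_def] by auto
      have "sum ?w ?E = K * mass n UNIV"
        using mass[of UNIV] by simp
      then show ?thesis
        using * K mass by (simp add: conditional_law_def)
    qed
    ultimately show ?thesis
      using assms(10) b by (intro LDP_of_mass[unfolded e_def]) (auto simp: \<kappa>_def b_def)
  qed
  ultimately show ?thesis by blast
qed

end
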